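(* Suppose the smoothness assumption, the sampling assumption and the strong convexity assumption (with parameter $\sigma_Z>0$) stated in the context hold. Let $\nu\ge\nu_{\max}$ be a constant, and for all $k\ge0$ let $$\gamma_k=\frac{1}{\sqrt{\sigma_Z\nu}}\le\frac1{\sigma_Z},\qquad \alpha_k=\frac{\gamma_k\sigma_Z}{1+\gamma_k\sigma_Z}\in(0,1],\qquad \beta_k=1-\gamma_k\sigma_Z\in[0,1].$$ Then the sequences generated by the accelerated random sketch descent (A-RSD) algorithm with these parameters satisfy, for every $k\ge0$, $$\mathbf{E}\Big[r_k^2+\frac{2}{\sigma_Z}\big(f(x^k)-f^*\big)\Big]\;\le\;\Big(1-\sqrt{\frac{\sigma_Z}{\nu}}\Big)^k\Big(r_0^2+\frac{2}{\sigma_Z}\big(f(x^0)-f^*\big)\Big),$$ where $r_k^2=\|v^k-x^*\|_{Z^\dagger}^2$ and $x^*$ is an optimal point of the problem.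
   Context: Problem: $f^*=\min_{x\in\mathbb{R}^n} f(x)$ subject to $Ax=b$, where $f:\mathbb{R}^n\to\mathbb{R}$ is differentiable, $A\in\mathbb{R}^{m\times n}$ with $m<n$ (the paper: $m\ll n$), and the feasible set is nonempty. A point $x^0$ with $Ax^0=b$ is fixed; the feasible set is $x^0+\ker(A)$. Smoothness assumption: there is a symmetric positive semidefinite matrix $M\in\mathbb{R}^{n\times n}$, positive definite on $\ker(A)$ (i.e. $u^TMu>0$ for all nonzero $u\in\ker(A)$), such that $f(y)\le f(x)+\langle\nabla f(x),y-x\rangle+\tfrac12 (y-x)^TM(y-x)$ for all $x,y\in x^0+\ker(A)$. Sketching: $\mathcal{S}$ is a probability distribution on matrices $S\in\mathbb{R}^{n\times p}$ ($p$ may itself be random). $B^\dagger$ denotes the Moore–Penrose pseudo-inverse of $B$. Put $P_S=I_p-(AS)^\dagger(AS)$, $Z_S=SP_S(P_S^TS^TMSP_S)^\dagger P_S^TS^T\in\mathbb{R}^{n\times n}$, and $Z=\mathbf{E}_{S\sim\mathcal{S}}[Z_S]$. Sampling assumption: $Z_S$ has finite mean, and $Z$ is positive definite on $\ker(A)$. Norms: $\|u\|_Z=\sqrt{u^TZu}$ and $\|u\|_{Z^\dagger}=\sqrt{u^TZ^\dagger u}$ for $u\in\mathbb{R}^n$; for $x\in\ker(A)$, $\|x\|_Z^*=\max_{u\in\mathbb{R}^n:\|u\|_Z\le1}\langle x,u\rangle=\|x\|_{Z^\dagger}$. Strong convexity assumption: there is $\sigma_Z>0$ with $f(x)\ge f(y)+\langle\nabla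 f(y),x-y\rangle+\tfrac{\sigma_Z}{2}(\|x-y\|_Z^* )^2$ for all $x,y\in x^0+\ker(A)$. Constant: $\nu_{\max}=\max_{u\in\ker(A),\,u\ne0}\dfrac{\mathbf{E}_{S\sim\mathcal S}[\|Z_Su\|_{Z^\dagger}^2]}{\|u\|_Z^2}$. A-RSD algorithm (parameters: sequences $\alpha_k,\beta_k,\gamma_k$): start with the feasible $x^0$ and $v^0=x^0$; at each iteration $k\ge0$ sample $S\sim\mathcal{S}$ (independently of the past) and set $y^k=\alpha_kv^k+(1-\alpha_k)x^k$, $x^{k+1}=y^k-Z_S\nabla f(y^k)$, $v^{k+1}=\beta_kv^k+(1-\beta_k)y^k-\gamma_kZ_S\nabla f(y^k)$. $\mathbf{E}$ (without subscript) is the expectation over all sampled sketch matrices. *)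

theory Defs
  imports
    "HOL-Probability.Probability"
    "Jordan_Normal_Form.Matrix"
begin

text \<open>
  Points and the fixed matrices live in \<open>real ^ 'n\<close>, \<open>real ^ 'n ^ 'm\<close>.  A sketch matrix has a random
  number of columns, so it is a \<open>real mat\<close>, which carries its own dimensions.
\<close>

no_notation Matrix.vec_index (infixl "$" 100)
no_notation Matrix.scalar_prod (infix "\<bullet>" 70)
hide_const (open) Matrix.vec Matrix.mat
hide_type (open) Matrix.vec

text \<open>
  The finite index types are numbered by the library bijections \<^const>\<open>from_nat_into\<close> and
  \<^const>\<open>to_nat_on\<close> between \<open>{..<CARD('n)}\<close> and \<open>UNIV :: 'n set\<close>.
\<close>

definition to_mat :: "real ^ 'c ^ 'r \<Rightarrow> real mat" where
  "to_mat X = Matrix.mat CARD('r) CARD('c)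
     (\<lambda>(i, j). X $ from_nat_into (UNIV :: 'r set) i $ from_nat_into (UNIV :: 'c set) j)"

definition of_mat :: "real mat \<Rightarrow> real ^ 'c ^ 'r" where
  "of_mat Y = (\<chi> i j. Y $$ (to_nat_on (UNIV :: 'r set) i, to_nat_on (UNIV :: 'c set) j))"

definition is_moore_penrose :: "real mat \<Rightarrow> real mat \<Rightarrow> bool" where
  "is_moore_penrose B X \<longleftrightarrow>
     X \<in> carrier_mat (dim_col B) (dim_row B) \<and>
     B * X * B = B \<and> X * B * X = X \<and>
     (B * X)\<^sup>T = B * X \<and> (X * B)\<^sup>T = X * B"

definition pinv :: "real mat \<Rightarrow> real mat" where
  "pinv B = (THE X. is_moore_penrose B X)"

definition pseudo_inverse :: "real ^ 'n ^ 'm \<Rightarrow> real ^ 'm ^ 'n" where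
  "pseudo_inverse B = of_mat (pinv (to_mat B))"

definition mat_ker :: "real ^ 'n ^ 'm \<Rightarrow> (real ^ 'n) set" where
  "mat_ker A = {u. A *v u = 0}"

definition feasible :: "real ^ 'n ^ 'm \<Rightarrow> real ^ 'm \<Rightarrow> (real ^ 'n) set" where
  "feasible A b = {x. A *v x = b}"

definition pos_def_on :: "(real ^ 'n) set \<Rightarrow> real ^ 'n ^ 'n \<Rightarrow> bool" where
  "pos_def_on K M \<longleftrightarrow> (\<forall>u\<in>K. u \<noteq> 0 \<longrightarrow> u \<bullet> (M *v u) > 0)"

definition sym_pos_semidef :: "real ^ 'n ^ 'n \<Rightarrow> bool" where
  "sym_pos_semidef M \<longleftrightarrow> transpose M = M \<and> (\<forall>u. u \<bullet> (M *v u) \<ge> 0)"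

definition optimal_value :: "(real ^ 'n \<Rightarrow> real) \<Rightarrow> real ^ 'n ^ 'm \<Rightarrow> real ^ 'm \<Rightarrow> real" where
  "optimal_value f A b = (LEAST t. t \<in> f ` feasible A b)"

definition mat_norm :: "real ^ 'n ^ 'n \<Rightarrow> real ^ 'n \<Rightarrow> real" where
  "mat_norm Q u = sqrt (u \<bullet> (Q *v u))"

text \<open>
  For \<open>x \<in> ker A\<close> and \<open>Q\<close> the mean sketch matrix below, this maximum is attained and equals
  \<open>mat_norm (pseudo_inverse Q) x\<close>.
\<close>

definition dual_norm :: "real ^ 'n ^ 'n \<Rightarrow> real ^ 'n \<Rightarrow> real" where
  "dual_norm Q x = (GREATEST t. \<exists>u. mat_norm Q u \<le> 1 \<and> t = x \<bullet> u)"

definition sketch_proj :: "real ^ 'n ^ 'm \<Rightarrow> real mat \<Rightarrow> real mat" where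
  "sketch_proj A S = 1\<^sub>m (dim_col S) - pinv (to_mat A * S) * (to_mat A * S)"

definition sketch_Z :: "real ^ 'n ^ 'm \<Rightarrow> real ^ 'n ^ 'n \<Rightarrow> real mat \<Rightarrow> real ^ 'n ^ 'n" where
  "sketch_Z A M S =
     (let P = sketch_proj A S
      in of_mat (S * P * pinv (P\<^sup>T * S\<^sup>T * to_mat M * S * P) * P\<^sup>T * S\<^sup>T))"

definition mean_Z :: "real ^ 'n ^ 'm \<Rightarrow> real ^ 'n ^ 'n \<Rightarrow> real mat measure \<Rightarrow> real ^ 'n ^ 'n" where
  "mean_Z A M D = (\<integral>S. sketch_Z A M S \<partial>D)"

text \<open>
  A distribution of sketch matrices with \<open>CARD('n)\<close> rows.  The sigma-algebra is left open, which
  covers the Borel sets of the disjoint union over \<open>p\<close> of the spaces of \<open>n \<times> p\<close> matrices; the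
  measurability that matters is that of \<^const>\<open>sketch_Z\<close>, part of its having a finite mean.
\<close>

definition sketch_distribution :: "'n itself \<Rightarrow> real mat measure \<Rightarrow> bool" where
  "sketch_distribution _ D \<longleftrightarrow> prob_space D \<and> space D \<subseteq> {S. dim_row S = CARD('n)}"

definition nu_max :: "real ^ 'n ^ 'm \<Rightarrow> real ^ 'n ^ 'n \<Rightarrow> real mat measure \<Rightarrow> real" where
  "nu_max A M D =
     (let Z = mean_Z A M D
      in GREATEST t. \<exists>u\<in>mat_ker A. u \<noteq> 0 \<and>
           t = (\<integral>S. (mat_norm (pseudo_inverse Z) (sketch_Z A M S *v u))\<^sup>2 \<partial>D) / (mat_norm Z u)\<^sup>2)"

text \<open>
  One run of the accelerated method with gradient \<open>g\<close>, where \<open>Zs k\<close> is the matrix used in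
  iteration \<open>k\<close>; the result is the pair \<open>(x\<^sup>k, v\<^sup>k)\<close>.
\<close>

primrec arsd :: "(real ^ 'n \<Rightarrow> real ^ 'n) \<Rightarrow> (nat \<Rightarrow> real ^ 'n ^ 'n) \<Rightarrow>
    (nat \<Rightarrow> real) \<Rightarrow> (nat \<Rightarrow> real) \<Rightarrow> (nat \<Rightarrow> real) \<Rightarrow> real ^ 'n \<Rightarrow>
    nat \<Rightarrow> (real ^ 'n) \<times> (real ^ 'n)" where
  "arsd g Zs \<alpha> \<beta> \<gamma> x0 0 = (x0, x0)"
| "arsd g Zs \<alpha> \<beta> \<gamma> x0 (Suc k) =
     (let (x, v) = arsd g Zs \<alpha> \<beta> \<gamma> x0 k;
          y = \<alpha> k *\<^sub>R v + (1 - \<alpha> k) *\<^sub>R x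
      in (y - Zs k *v g y,
          \<beta> k *\<^sub>R v + (1 - \<beta> k) *\<^sub>R y - \<gamma> k *\<^sub>R (Zs k *v g y)))"

end

theory Submission
  imports Defs
begin

text \<open>
  Let \<open>r\<close> be the distance of \<open>v\<close> from the minimizer in the norm of the pseudo-inverse \<open>Z\<^sup>+\<close> of the
  mean sketch matrix \<open>Z\<close>.  The convergence rate is the contraction factor of the potential
  \<open>r\<^sup>2 + 2 / \<sigma> * (f x - f\<^sup>*)\<close> in one iteration, and the algorithm's parameters are exactly those for
  which the terms of that one-step estimate cancel.

  A sketch matrix \<open>Z\<^sub>S\<close> is symmetric, takes values in \<open>ker A\<close> and satisfies \<open>Z\<^sub>S M Z\<^sub>S = Z\<^sub>S\<close>
  (\<open>sketch_Z_algebra\<close>).  By the last identity the smoothness assumption becomes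
  \<open>f (y - Z\<^sub>S g) \<le> f y - (g \<bullet> Z\<^sub>S g) / 2\<close> for \<open>g\<close> the gradient at \<open>y\<close> (\<open>descent\<close>).
  Averaging over \<open>S\<close> makes the decrease half the squared norm \<open>g \<bullet> Z g\<close>.  The new \<open>v\<close> differs
  from the minimizer by \<open>c - \<gamma> Z\<^sub>S g\<close>, where \<open>c\<close> is the convex combination of the differences for
  the old \<open>v\<close> and for \<open>y\<close> with weights \<open>\<beta>\<close> and \<open>1 - \<beta>\<close>.  Expanding its squared norm and taking
  the mean, the linear term becomes \<open>c \<bullet> Z\<^sup>+ Z g = c \<bullet> g\<close>, because \<open>Z\<^sup>+ Z\<close> is the orthogonal
  projection onto \<open>ker A\<close> and \<open>c \<in> ker A\<close>; the quadratic term is at most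
  \<open>\<gamma>\<^sup>2 * \<nu> * (g \<bullet> Z g)\<close> by the definition of \<open>\<nu>\<^sub>m\<^sub>a\<^sub>x\<close>.  As \<open>\<gamma>\<^sup>2 * \<nu> = 1 / \<sigma>\<close>, the quadratic
  term is paid for by the decrease of \<open>f\<close>.  With
  \<open>t = sqrt (\<sigma> / \<nu>)\<close> the choice of \<open>\<alpha>\<close> gives \<open>t * (v - y) = y - x\<close>, which splits \<open>c \<bullet> g\<close> into a
  part pointing at the minimizer, estimated by strong convexity, and a part pointing at \<open>x\<close>,
  estimated by convexity.  What remains is \<open>1 - t\<close> times the old potential
  (\<open>nn_integral_potential_step\<close>).

  The sketch used in iteration \<open>k\<close> is independent of the iterates computed before, so Tonelli's
  theorem makes the one-step estimate a recursion for the expected potential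
  (\<open>nn_integral_potential_arsd\<close>).  It is carried out with integrals of nonnegative functions, and
  yields integrability together with the bound.

  Two facts make these steps meaningful.  First, \<open>M\<close> is coercive on \<open>ker A\<close>, so \<open>Z\<^sub>S M Z\<^sub>S = Z\<^sub>S\<close>
  bounds all sketch matrices uniformly (\<open>Zs_bounded\<close>): second moments exist and the maximum in
  \<open>\<nu>\<^sub>m\<^sub>a\<^sub>x\<close> is attained.  Secondly, \<open>\<sigma> \<le> 1 \<le> \<nu>\<^sub>m\<^sub>a\<^sub>x\<close>, hence \<open>t \<le> 1\<close>.  Both inequalities are
  instances of Jensen's inequality for a quadratic form at \<open>Z\<^sub>S\<close>: the form \<open>M\<close> gives
  \<open>M \<le> Z\<^sup>+\<close> on \<open>ker A\<close>, while smoothness and strong convexity squeeze \<open>\<sigma> Z\<^sup>+ \<le> M\<close>, and the form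
  \<open>Z\<^sup>+\<close> gives \<open>Z \<le> E (Z\<^sub>S Z\<^sup>+ Z\<^sub>S)\<close>.
\<close>

section \<open>The Moore--Penrose inverse of a real matrix\<close>

text \<open>
  Ring laws whose side conditions are equations between dimensions.  In this form the simplifier
  discharges them by computing dimensions, and matrix identities can be proved by rewriting.
\<close>

lemma mat_mult_assoc_dims:
  fixes B C E :: "real mat"
  assumes "dim_col B = dim_row C" "dim_col C = dim_row E"
  shows "B * C * E = B * (C * E)"
  by (rule assoc_mult_mat) (use assms in auto)

lemma transpose_mult_dims:
  fixes B C :: "real mat"
  assumes "dim_col B = dim_row C"
  shows "(B * C)\<^sup>T = C\<^sup>T * B\<^sup>T"
  by (rule transpose_mult) (use assms in auto)

lemma mat_mult_minus_dims:
  fixes B C E :: "real mat"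
  assumes "dim_col B = dim_row C" "dim_row E = dim_row C" "dim_col E = dim_col C"
  shows "B * (C - E) = B * C - B * E"
  by (rule mult_minus_distrib_mat) (use assms in auto)

lemma mat_minus_mult_dims:
  fixes B C E :: "real mat"
  assumes "dim_row C = dim_row B" "dim_col C = dim_col B" "dim_col B = dim_row E"
  shows "(B - C) * E = B * E - C * E"
  by (rule minus_mult_distrib_mat) (use assms in auto)

lemma mat_mult_add_dims:
  fixes B C E :: "real mat"
  assumes "dim_col B = dim_row C" "dim_row E = dim_row C" "dim_col E = dim_col C"
  shows "B * (C + E) = B * C + B * E"
  by (rule mult_add_distrib_mat) (use assms in auto)

lemma mat_add_mult_dims:
  fixes B C E :: "real mat"
  assumes "dim_row C = dim_row B" "dim_col C = dim_col B" "dim_col B = dim_row E"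
  shows "(B + C) * E = B * E + C * E"
  by (rule add_mult_distrib_mat) (use assms in auto)

lemma transpose_minus_dims:
  fixes B C :: "real mat"
  assumes "dim_row C = dim_row B" "dim_col C = dim_col B"
  shows "(B - C)\<^sup>T = B\<^sup>T - C\<^sup>T"
  by (rule transpose_minus) (use assms in auto)

lemmas mat_dims = mat_mult_assoc_dims transpose_mult_dims mat_mult_minus_dims
  mat_minus_mult_dims transpose_minus_dims

lemma mat_minus_eq_zero_iff:
  fixes B C :: "real mat"
  assumes "dim_row C = dim_row B" "dim_col C = dim_col B"
  shows "B - C = 0\<^sub>m (dim_row B) (dim_col B) \<longleftrightarrow> B = C"
proof
  assume *: "B - C = 0\<^sub>m (dim_row B) (dim_col B)"
  show "B = C"
  proof (rule eq_matI)
    fix i j assume "i < dim_row C" "j < dim_col C"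
    then show "B $$ (i, j) = C $$ (i, j)"
      using arg_cong[OF *, of "\<lambda>Y. Y $$ (i, j)"] assms by simp
  qed (use assms in auto)
qed (use assms in auto)

lemma gram_eq_zero:
  fixes B :: "real mat"
  assumes "B\<^sup>T * B = 0\<^sub>m (dim_col B) (dim_col B)"
  shows "B = 0\<^sub>m (dim_row B) (dim_col B)"
proof (rule eq_matI)
  fix i j assume "i < dim_row (0\<^sub>m (dim_row B) (dim_col B) :: real mat)"
    and "j < dim_col (0\<^sub>m (dim_row B) (dim_col B) :: real mat)"
  then have i: "i < dim_row B" and j: "j < dim_col B" by auto
  have "(\<Sum>k\<in>{0..<dim_row B}. B $$ (k, j) * B $$ (k, j)) = (B\<^sup>T * B) $$ (j, j)"
    using j by (simp add: scalar_prod_def)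
  also have "\<dots> = 0" using assms j by simp
  finally have "B $$ (i, j) * B $$ (i, j) = 0"
    using i by (subst (asm) sum_nonneg_eq_0_iff) auto
  then show "B $$ (i, j) = 0\<^sub>m (dim_row B) (dim_col B) $$ (i, j)" using i j by simp
qed auto

text \<open>
  McCoy's lemma on von Neumann regularity: if \<open>B - B Y B\<close> has an inner inverse \<open>X\<close>, then so has
  \<open>B\<close>, namely \<open>Y + (1 - Y B) X (1 - B Y)\<close>.
\<close>

lemma inner_inverse_lift:
  fixes B Y X :: "real mat"
  assumes Y: "Y \<in> carrier_mat (dim_col B) (dim_row B)"
    and X: "X \<in> carrier_mat (dim_col B) (dim_row B)"
    and X_inv: "(B - B * Y * B) * X * (B - B * Y * B) = B - B * Y * B"
  shows "\<exists>W \<in> carrier_mat (dim_col B) (dim_row B). B * W * B = B"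
proof -
  have XY [simp]: "dim_row Y = dim_col B" "dim_col Y = dim_row B"
    "dim_row X = dim_col B" "dim_col X = dim_row B"
    using X Y by auto
  define E where "E = 1\<^sub>m (dim_col B) - Y * B"
  define F where "F = 1\<^sub>m (dim_row B) - B * Y"
  define W where "W = Y + E * (X * F)"
  have dims [simp]: "dim_row E = dim_col B" "dim_col E = dim_col B"
    "dim_row F = dim_row B" "dim_col F = dim_row B"
    by (simp_all add: E_def F_def)
  have one: "B * 1\<^sub>m (dim_col B) = B" "1\<^sub>m (dim_row B) * B = B"
    using right_mult_one_mat[of B] left_mult_one_mat[of B] by auto
  have BE: "B * E = B - B * Y * B" and FB: "F * B = B - B * Y * B"
    by (simp_all add: E_def F_def mat_dims one)
  have "B * W * B = B * Y * B + B * (E * (X * F)) * B"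
    by (simp add: W_def mat_mult_add_dims mat_add_mult_dims)
  also have "B * (E * (X * F)) * B = (B * E) * X * (F * B)"
    by (simp add: mat_dims)
  also have "\<dots> = B - B * Y * B"
    using X_inv by (simp add: BE FB)
  also have "B * Y * B + (B - B * Y * B) = B"
    by (rule eq_matI) auto
  finally have "B * W * B = B" .
  moreover have "W \<in> carrier_mat (dim_col B) (dim_row B)"
    by (rule carrier_matI) (simp_all add: W_def)
  ultimately show ?thesis by blast
qed

text \<open>
  Gaussian elimination in the form that McCoy's lemma asks for.  A nonzero entry \<open>B\<^sub>r\<^sub>c\<close> defines the
  rank-one \<open>Y\<close> with single entry \<open>1 / B\<^sub>r\<^sub>c\<close> at \<open>(c, r)\<close>.  Subtracting \<open>B Y B\<close> clears row \<open>r\<close> and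
  leaves zero rows zero, so the number of nonzero rows decreases.
\<close>

lemma inner_inverse_exists:
  fixes B :: "real mat"
  shows "\<exists>X \<in> carrier_mat (dim_col B) (dim_row B). B * X * B = B"
proof (induction "card {i. i < dim_row B \<and> row B i \<noteq> 0\<^sub>v (dim_col B)}" arbitrary: B
    rule: less_induct)
  case less
  show ?case
  proof (cases "B = 0\<^sub>m (dim_row B) (dim_col B)")
    case True
    have "C * 0\<^sub>m c r * C = C" if "C = 0\<^sub>m r c" for C :: "real mat" and r c
      using that by simp
    from this[OF True] show ?thesis
      by (intro bexI[of _ "0\<^sub>m (dim_col B) (dim_row B)"]) auto
  next
    case False
    then obtain r c where r: "r < dim_row B" and c: "c < dim_col B" and rc: "B $$ (r, c) \<noteq> 0"
      by (metis eq_matI index_zero_mat)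
    define Y where "Y = Matrix.mat (dim_col B) (dim_row B)
      (\<lambda>(i, j). if i = c \<and> j = r then 1 / B $$ (r, c) else 0)"
    have Y: "Y \<in> carrier_mat (dim_col B) (dim_row B)" by (simp add: Y_def)
    define C where "C = B - B * Y * B"
    have dim [simp]: "dim_row C = dim_row B" "dim_col C = dim_col B"
      "dim_row Y = dim_col B" "dim_col Y = dim_row B"
      by (auto simp: C_def Y_def)
    have BY: "(B * Y) $$ (i, j) = (if j = r then B $$ (i, c) / B $$ (r, c) else 0)"
      if "i < dim_row B" "j < dim_row B" for i j
      using that c by (auto simp: scalar_prod_def Y_def if_distrib cong: if_cong)
    have C: "C $$ (i, j) = B $$ (i, j) - B $$ (i, c) / B $$ (r, c) * B $$ (r, j)"
      if "i < dim_row B" "j < dim_col B" for i j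
    proof -
      have "(B * Y * B) $$ (i, j) = (\<Sum>k\<in>{0..<dim_row B}. (B * Y) $$ (i, k) * B $$ (k, j))"
        using that by (simp add: scalar_prod_def)
      also have "\<dots> = (\<Sum>k\<in>{0..<dim_row B}. if k = r then B $$ (i, c) / B $$ (r, c) * B $$ (k, j) else 0)"
      proof (intro sum.cong refl)
        fix k assume "k \<in> {0..<dim_row B}"
        then have "(B * Y) $$ (i, k) = (if k = r then B $$ (i, c) / B $$ (r, c) else 0)"
          using that by (intro BY) auto
        then show "(B * Y) $$ (i, k) * B $$ (k, j)
            = (if k = r then B $$ (i, c) / B $$ (r, c) * B $$ (k, j) else 0)"
          by (cases "k = r") (simp_all only: if_True if_False mult_zero_left simp_thms)
      qed
      also have "\<dots> = B $$ (i, c) / B $$ (r, c) * B $$ (r, j)"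
        using r by simp
      finally show ?thesis using that by (simp add: C_def)
    qed
    have "{i. i < dim_row C \<and> row C i \<noteq> 0\<^sub>v (dim_col C)}
        \<subset> {i. i < dim_row B \<and> row B i \<noteq> 0\<^sub>v (dim_col B)}"
    proof (rule psubsetI)
      show "{i. i < dim_row C \<and> row C i \<noteq> 0\<^sub>v (dim_col C)}
        \<subseteq> {i. i < dim_row B \<and> row B i \<noteq> 0\<^sub>v (dim_col B)}"
      proof (safe, simp)
        fix i assume i: "i < dim_row C" and nz: "row C i \<noteq> 0\<^sub>v (dim_col C)"
          and 0: "row B i = 0\<^sub>v (dim_col B)"
        have B0: "B $$ (i, j) = 0" if "j < dim_col B" for j
          using arg_cong[OF 0, of "\<lambda>v. Matrix.vec_index v j"] that i by simp
        have "row C i = 0\<^sub>v (dim_col C)"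
          by (rule eq_vecI) (use i c B0 in \<open>auto simp: C\<close>)
        with nz show False by simp
      qed
      have "row C r = 0\<^sub>v (dim_col C)"
        by (rule eq_vecI) (use r rc in \<open>auto simp: C\<close>)
      moreover have "row B r \<noteq> 0\<^sub>v (dim_col B)"
      proof
        assume "row B r = 0\<^sub>v (dim_col B)"
        from arg_cong[OF this, of "\<lambda>v. Matrix.vec_index v c"] show False using r c rc by simp
      qed
      ultimately show "{i. i < dim_row C \<and> row C i \<noteq> 0\<^sub>v (dim_col C)}
          \<noteq> {i. i < dim_row B \<and> row B i \<noteq> 0\<^sub>v (dim_col B)}"
        using r by auto
    qed
    then have "card {i. i < dim_row C \<and> row C i \<noteq> 0\<^sub>v (dim_col C)}
        < card {i. i < dim_row B \<and> row B i \<noteq> 0\<^sub>v (dim_col B)}"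
      by (intro psubset_card_mono) auto
    from less[OF this] obtain X where X: "X \<in> carrier_mat (dim_col B) (dim_row B)"
      and "C * X * C = C" by auto
    then show ?thesis
      using inner_inverse_lift[OF Y X] by (simp add: C_def)
  qed
qed

text \<open>
  The least-squares inverse \<open>(B\<^sup>T B)\<^sup>- B\<^sup>T\<close>.  With \<open>C = B X B - B\<close> the inner inverse property
  of the Gram matrix says \<open>B\<^sup>T C = 0\<close>, hence \<open>C\<^sup>T C = 0\<close>, and a real matrix with zero Gram
  matrix vanishes.
\<close>

lemma symmetric_inner_inverse_exists:
  fixes B :: "real mat"
  shows "\<exists>X \<in> carrier_mat (dim_col B) (dim_row B). B * X * B = B \<and> (B * X)\<^sup>T = B * X"
proof -
  obtain W where W: "W \<in> carrier_mat (dim_col B) (dim_col B)"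
    and W_inv: "B\<^sup>T * B * W * (B\<^sup>T * B) = B\<^sup>T * B"
    using inner_inverse_exists[of "B\<^sup>T * B"] by auto
  define X where "X = W * B\<^sup>T"
  define C where "C = B * X * B - B"
  have dims [simp]: "dim_row W = dim_col B" "dim_col W = dim_col B"
    "dim_row X = dim_col B" "dim_col X = dim_row B" "dim_row C = dim_row B" "dim_col C = dim_col B"
    using W by (auto simp: X_def C_def)
  have BC: "B\<^sup>T * C = 0\<^sub>m (dim_col B) (dim_col B)"
  proof -
    have "B\<^sup>T * C = B\<^sup>T * B * W * (B\<^sup>T * B) - B\<^sup>T * B"
      by (simp add: C_def X_def mat_dims)
    also have "\<dots> = 0\<^sub>m (dim_col B) (dim_col B)"
      unfolding W_inv by (rule eq_matI) auto
    finally show ?thesis .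
  qed
  have "C\<^sup>T * C = ((X * B)\<^sup>T * B\<^sup>T - B\<^sup>T) * C"
    by (simp add: C_def mat_dims)
  also have "\<dots> = (X * B)\<^sup>T * (B\<^sup>T * C) - B\<^sup>T * C"
    by (simp add: mat_dims)
  also have "\<dots> = 0\<^sub>m (dim_col B) (dim_col B)"
    unfolding BC by (rule eq_matI) auto
  finally have "C = 0\<^sub>m (dim_row B) (dim_col B)"
    using gram_eq_zero[of C] by simp
  then have BXB: "B * X * B = B"
    using mat_minus_eq_zero_iff[of B "B * X * B"] by (simp add: C_def)
  have "B * X = B * W * (B * X * B)\<^sup>T"
    by (simp only: BXB) (simp add: X_def mat_dims)
  also have "\<dots> = (B * W * (B * X * B)\<^sup>T)\<^sup>T"
    by (simp add: X_def mat_dims)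
  also have "B * W * (B * X * B)\<^sup>T = B * X"
    by (simp only: BXB) (simp add: X_def mat_dims)
  finally have "(B * X)\<^sup>T = B * X" by (rule sym)
  moreover have "X \<in> carrier_mat (dim_col B) (dim_row B)"
    by (rule carrier_matI) simp_all
  ultimately show ?thesis using BXB by blast
qed

text \<open>
  If \<open>Y\<close> is an inner inverse with \<open>B Y\<close> symmetric and \<open>V\<close> one with \<open>V B\<close> symmetric (found by
  transposition), then \<open>V B Y\<close> has all four properties.
\<close>

lemma moore_penrose_exists: "\<exists>X. is_moore_penrose B X"
proof -
  obtain Y where Y: "Y \<in> carrier_mat (dim_col B) (dim_row B)" "B * Y * B = B" "(B * Y)\<^sup>T = B * Y"
    using symmetric_inner_inverse_exists by blast
  obtain W where W: "W \<in> carrier_mat (dim_row B) (dim_col B)"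
      "B\<^sup>T * W * B\<^sup>T = B\<^sup>T" "(B\<^sup>T * W)\<^sup>T = B\<^sup>T * W"
    using symmetric_inner_inverse_exists[of "B\<^sup>T"] by auto
  have dims [simp]: "dim_row Y = dim_col B" "dim_col Y = dim_row B"
    "dim_row W = dim_row B" "dim_col W = dim_col B"
    using Y W by auto
  define V where "V = W\<^sup>T"
  have V [simp]: "dim_row V = dim_col B" "dim_col V = dim_row B" by (auto simp: V_def)
  have BVB: "B * V * B = B"
    using arg_cong[OF W(2), of transpose_mat] by (simp add: V_def mat_dims)
  have VB: "(V * B)\<^sup>T = V * B"
    using W(3) by (simp add: V_def mat_dims)
  define X where "X = V * B * Y"
  have BX: "B * X = B * Y"
    using BVB by (simp add: X_def mat_mult_assoc_dims[symmetric])
  have XB: "X * B = V * B"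
    using Y(2) by (simp add: X_def mat_mult_assoc_dims)
  have "X * B * X = X"
    unfolding XB using BX by (simp add: mat_mult_assoc_dims X_def)
  moreover have "X \<in> carrier_mat (dim_col B) (dim_row B)"
    by (rule carrier_matI) (simp_all add: X_def)
  moreover have "B * X * B = B" "(B * X)\<^sup>T = B * X" "(X * B)\<^sup>T = X * B"
    unfolding BX XB using Y(2,3) VB by auto
  ultimately show ?thesis
    unfolding is_moore_penrose_def by blast
qed

text \<open>
  Both \<open>B X\<close> and \<open>B Y\<close> are the orthogonal projection onto the range of \<open>B\<close>; likewise \<open>X B\<close> and
  \<open>Y B\<close> agree.
\<close>

lemma moore_penrose_unique:
  assumes X: "is_moore_penrose B X" and Y: "is_moore_penrose B Y"
  shows "X = Y"
proof -
  have dims [simp]: "dim_row Y = dim_col B" "dim_col Y = dim_row B"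
    "dim_row X = dim_col B" "dim_col X = dim_row B"
    using X Y by (auto simp: is_moore_penrose_def)
  have x: "B * X * B = B" "X * B * X = X" "(B * X)\<^sup>T = B * X" "(X * B)\<^sup>T = X * B"
    and y: "B * Y * B = B" "Y * B * Y = Y" "(B * Y)\<^sup>T = B * Y" "(Y * B)\<^sup>T = Y * B"
    using X Y by (auto simp: is_moore_penrose_def)
  have "B * X = (B * Y * B) * X" by (simp only: y)
  also have "\<dots> = (B * Y)\<^sup>T * (B * X)\<^sup>T" by (simp only: x(3,4) y(3,4)) (simp add: mat_mult_assoc_dims)
  also have "\<dots> = (B * X * B * Y)\<^sup>T" by (simp add: mat_dims)
  also have "\<dots> = B * Y" by (simp only: x y)
  finally have BX: "B * X = B * Y" .
  have "X * B = X * (B * Y * B)" by (simp only: y)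
  also have "\<dots> = (X * B)\<^sup>T * (Y * B)\<^sup>T" by (simp only: x(3,4) y(3,4)) (simp add: mat_mult_assoc_dims)
  also have "\<dots> = (Y * (B * X * B))\<^sup>T" by (simp add: mat_dims)
  also have "\<dots> = Y * B" by (simp only: x y)
  finally have XB: "X * B = Y * B" .
  have "X = X * B * X" by (simp only: x)
  also have "\<dots> = Y * (B * X)" by (simp only: XB) (simp add: mat_mult_assoc_dims)
  also have "\<dots> = Y * B * Y" by (simp only: BX) (simp add: mat_mult_assoc_dims)
  finally show "X = Y" by (simp only: y)
qed

lemma pinv_is_moore_penrose: "is_moore_penrose B (pinv B)"
proof -
  obtain X where "is_moore_penrose B X" using moore_penrose_exists by blast
  then show ?thesis unfolding pinv_def by (rule theI) (erule moore_penrose_unique, fact)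
qed

lemma pinv_eqI: "is_moore_penrose B X \<Longrightarrow> pinv B = X"
  using pinv_is_moore_penrose moore_penrose_unique by blast

lemma pinv_dims [simp]: "dim_row (pinv B) = dim_col B" "dim_col (pinv B) = dim_row B"
  using pinv_is_moore_penrose[of B] by (auto simp: is_moore_penrose_def)

lemma pinv_inverse: "B * pinv B * B = B" "pinv B * B * pinv B = pinv B"
  "(B * pinv B)\<^sup>T = B * pinv B" "(pinv B * B)\<^sup>T = pinv B * B"
  using pinv_is_moore_penrose[of B] by (auto simp: is_moore_penrose_def)

lemma pinv_transpose: "pinv (B\<^sup>T) = (pinv B)\<^sup>T"
proof (rule pinv_eqI, unfold is_moore_penrose_def, intro conjI)
  have "(B * pinv B * B)\<^sup>T = B\<^sup>T" by (simp only: pinv_inverse)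
  then show "B\<^sup>T * (pinv B)\<^sup>T * B\<^sup>T = B\<^sup>T" by (simp add: mat_dims)
  have "(pinv B * B * pinv B)\<^sup>T = (pinv B)\<^sup>T" by (simp only: pinv_inverse)
  then show "(pinv B)\<^sup>T * B\<^sup>T * (pinv B)\<^sup>T = (pinv B)\<^sup>T" by (simp add: mat_dims)
  show "(B\<^sup>T * (pinv B)\<^sup>T)\<^sup>T = B\<^sup>T * (pinv B)\<^sup>T"
    using pinv_inverse(4)[of B] by (simp add: mat_dims)
  show "((pinv B)\<^sup>T * B\<^sup>T)\<^sup>T = (pinv B)\<^sup>T * B\<^sup>T"
    using pinv_inverse(3)[of B] by (simp add: mat_dims)
  show "(pinv B)\<^sup>T \<in> carrier_mat (dim_col (B\<^sup>T)) (dim_row (B\<^sup>T))"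
    by (rule carrier_matI) simp_all
qed

section \<open>Algebra of the sketch matrix\<close>

text \<open>
  These inverse laws make \<open>to_mat\<close> and \<open>of_mat\<close> mutually inverse, so that identities between
  matrices over finite index types can be proved after translation to dimension-carrying ones.
\<close>

lemma numbering_inverse:
  "from_nat_into UNIV (to_nat_on UNIV i) = (i :: 'a::finite)"
  "n < CARD('a) \<Longrightarrow> to_nat_on (UNIV :: 'a set) (from_nat_into UNIV n) = n"
  "to_nat_on UNIV i < CARD('a)"
proof -
  have bij: "bij_betw (to_nat_on (UNIV :: 'a set)) UNIV {..<CARD('a)}"
    by (rule to_nat_on_finite) simp
  show "from_nat_into UNIV (to_nat_on UNIV i) = i"
    by (rule from_nat_into_to_nat_on) auto
  show "to_nat_on UNIV i < CARD('a)"
    using bij by (auto simp: bij_betw_def)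
  show "to_nat_on (UNIV :: 'a set) (from_nat_into UNIV n) = n" if "n < CARD('a)"
    using bij that by (intro to_nat_on_from_nat_into) (auto simp: bij_betw_def)
qed

lemma to_mat_dims [simp]:
  "dim_row (to_mat (X :: real ^ 'c ^ 'r)) = CARD('r)"
  "dim_col (to_mat (X :: real ^ 'c ^ 'r)) = CARD('c)"
  by (simp_all add: to_mat_def)

lemma of_mat_to_mat [simp]: "of_mat (to_mat X) = X"
  by (simp add: of_mat_def to_mat_def numbering_inverse vec_eq_iff)

lemma to_mat_of_mat:
  assumes "dim_row Y = CARD('r)" "dim_col Y = CARD('c)"
  shows "to_mat (of_mat Y :: real ^ 'c ^ 'r) = Y"
  by (rule eq_matI) (use assms in \<open>auto simp: of_mat_def to_mat_def numbering_inverse\<close>)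

lemma to_mat_inject: "to_mat X = to_mat Y \<longleftrightarrow> X = Y"
  by (metis of_mat_to_mat)

lemma to_mat_mult: "to_mat (X ** Y) = to_mat X * to_mat Y"
  for X :: "real ^ 'k ^ 'r" and Y :: "real ^ 'c ^ 'k"
proof (rule eq_matI)
  fix i j assume "i < dim_row (to_mat X * to_mat Y)" "j < dim_col (to_mat X * to_mat Y)"
  then have ij: "i < CARD('r)" "j < CARD('c)" by auto
  let ?i = "from_nat_into (UNIV :: 'r set) i" and ?j = "from_nat_into (UNIV :: 'c set) j"
  have "(\<Sum>k\<in>UNIV. X $ ?i $ k * Y $ k $ ?j)
      = (\<Sum>k<CARD('k). X $ ?i $ from_nat_into UNIV k * Y $ from_nat_into UNIV k $ ?j)"
    by (rule sum.reindex_bij_betw[symmetric], rule bij_betw_from_nat_into_finite) simp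
  then show "to_mat (X ** Y) $$ (i, j) = (to_mat X * to_mat Y) $$ (i, j)"
    using ij by (simp add: to_mat_def matrix_matrix_mult_def scalar_prod_def atLeast0LessThan)
qed auto

lemma to_mat_transpose: "to_mat (transpose X) = (to_mat X)\<^sup>T"
  by (rule eq_matI) (auto simp: to_mat_def Finite_Cartesian_Product.transpose_def)

lemma to_mat_zero: "to_mat (0 :: real ^ 'c ^ 'r) = 0\<^sub>m CARD('r) CARD('c)"
  by (rule eq_matI) (auto simp: to_mat_def)

lemma to_mat_pseudo_inverse: "to_mat (pseudo_inverse B) = pinv (to_mat B)"
  unfolding pseudo_inverse_def by (rule to_mat_of_mat) simp_all

lemma pseudo_inverse_inverse:
  "B ** pseudo_inverse B ** B = B"
  "pseudo_inverse B ** B ** pseudo_inverse B = pseudo_inverse B"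
  "transpose (B ** pseudo_inverse B) = B ** pseudo_inverse B"
  "transpose (pseudo_inverse B ** B) = pseudo_inverse B ** B"
  by (simp_all add: to_mat_inject[symmetric] to_mat_mult to_mat_transpose to_mat_pseudo_inverse
      pinv_inverse del: transpose_transpose)

lemma pseudo_inverse_transpose: "pseudo_inverse (transpose B) = transpose (pseudo_inverse B)"
  by (simp add: to_mat_inject[symmetric] to_mat_transpose to_mat_pseudo_inverse pinv_transpose)

text \<open>
  Write \<open>B = S P\<^sub>S\<close> and \<open>G = B\<^sup>T M B\<close>, so that \<open>Z\<^sub>S = B G\<^sup>+ B\<^sup>T\<close>.  Symmetry is inherited from
  \<open>G\<^sup>+\<close>; \<open>Z\<^sub>S M Z\<^sub>S = B G\<^sup>+ G G\<^sup>+ B\<^sup>T\<close> collapses by \<open>G\<^sup>+ G G\<^sup>+ = G\<^sup>+\<close>; and \<open>A B\<close> vanishes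
  because \<open>P\<^sub>S\<close> removes from \<open>S\<close> the directions that \<open>A S\<close> sees.
\<close>

lemma sketch_Z_algebra:
  fixes A :: "real ^ 'n ^ 'm" and M :: "real ^ 'n ^ 'n"
  assumes S: "dim_row S = CARD('n)" and M: "transpose M = M"
  shows transpose_sketch_Z: "transpose (sketch_Z A M S) = sketch_Z A M S"
    and sketch_Z_M_sketch_Z: "sketch_Z A M S ** M ** sketch_Z A M S = sketch_Z A M S"
    and A_sketch_Z: "A ** sketch_Z A M S = 0"
proof -
  define B where "B = S * sketch_proj A S"
  define G where "G = B\<^sup>T * to_mat M * B"
  define Y where "Y = B * pinv G * B\<^sup>T"
  have P [simp]: "dim_row (sketch_proj A S) = dim_col S" "dim_col (sketch_proj A S) = dim_col S"
    by (simp_all add: sketch_proj_def)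
  have B [simp]: "dim_row B = CARD('n)" "dim_col B = dim_col S"
    using S by (simp_all add: B_def)
  have G [simp]: "dim_row G = dim_col S" "dim_col G = dim_col S"
    by (simp_all add: G_def)
  have Y: "dim_row Y = CARD('n)" "dim_col Y = CARD('n)"
    by (simp_all add: Y_def)
  have "sketch_Z A M S = of_mat Y"
    using S by (simp add: sketch_Z_def Let_def Y_def G_def B_def mat_dims)
  then have Z: "to_mat (sketch_Z A M S) = Y"
    using to_mat_of_mat[OF Y] by simp
  have M': "(to_mat M)\<^sup>T = to_mat M"
    using M by (simp add: to_mat_transpose[symmetric])
  have "G\<^sup>T = G"
    by (simp add: G_def mat_dims M')
  then have pinv_G: "(pinv G)\<^sup>T = pinv G"
    using pinv_transpose[of G] by simp
  have "Y\<^sup>T = Y"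
    by (simp add: Y_def mat_dims pinv_G)
  then show "transpose (sketch_Z A M S) = sketch_Z A M S"
    by (simp add: to_mat_inject[symmetric] to_mat_transpose Z)
  have "Y * to_mat M * Y = B * (pinv G * G * pinv G) * B\<^sup>T"
    by (simp add: Y_def G_def mat_dims)
  then have "Y * to_mat M * Y = Y"
    by (simp only: pinv_inverse Y_def)
  then show "sketch_Z A M S ** M ** sketch_Z A M S = sketch_Z A M S"
    by (simp add: to_mat_inject[symmetric] to_mat_mult Z)
  have AS: "dim_col (to_mat A) = dim_row S" using S by simp
  have one: "to_mat A * S * 1\<^sub>m (dim_col S) = to_mat A * S"
    using right_mult_one_mat[of "to_mat A * S"] by auto
  have "to_mat A * B = to_mat A * S * sketch_proj A S"
    using S by (simp add: B_def mat_dims)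
  also have "\<dots> = to_mat A * S * 1\<^sub>m (dim_col S)
      - to_mat A * S * pinv (to_mat A * S) * (to_mat A * S)"
    unfolding sketch_proj_def using S
    by (simp add: mat_mult_minus_dims mat_mult_assoc_dims)
  also have "\<dots> = 0\<^sub>m CARD('m) (dim_col S)"
    unfolding pinv_inverse one by (rule eq_matI) auto
  finally have "to_mat A * B = 0\<^sub>m CARD('m) (dim_col S)" .
  moreover have "to_mat A * Y = to_mat A * B * (pinv G * B\<^sup>T)"
    by (simp add: Y_def mat_mult_assoc_dims)
  ultimately have "to_mat A * Y = 0\<^sub>m CARD('m) CARD('n)"
    by (simp add: left_mult_zero_mat[of _ "dim_col S" "CARD('n)"])
  then show "A ** sketch_Z A M S = 0"
    by (simp add: to_mat_inject[symmetric] to_mat_mult to_mat_zero Z)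
qed

section \<open>Geometry on the kernel and moments of the sketch matrix\<close>

lemma inner_symmetric_matrix:
  assumes "transpose Q = (Q :: real ^ 'n ^ 'n)"
  shows "x \<bullet> (Q *v y) = (Q *v x) \<bullet> y"
proof -
  have "x \<bullet> (Q *v y) = (transpose Q *v x) \<bullet> y"
    by (simp add: dot_lmul_matrix)
  then show ?thesis using assms by simp
qed

lemma mat_norm_power2:
  assumes "x \<bullet> (Q *v x) \<ge> 0"
  shows "(mat_norm Q x)\<^sup>2 = x \<bullet> (Q *v x)"
  using assms by (simp add: mat_norm_def)

lemma subspace_mat_ker: "subspace (mat_ker A)"
  by (auto simp: subspace_def mat_ker_def matrix_vector_right_distrib matrix_vector_mult_scaleR)

lemma closed_mat_ker: "closed (mat_ker A)"
  by (rule closed_subspace, rule subspace_mat_ker)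

lemma mat_ker_nontrivial:
  fixes A :: "real ^ 'n ^ 'm"
  assumes "CARD('m) < CARD('n)"
  obtains u where "u \<in> mat_ker A" "u \<noteq> 0"
proof -
  have "rank A \<le> CARD('m)" using rank_bound[of A] by simp
  then show ?thesis
    using matrix_nonfull_linear_equations_eq[of A] assms that by (auto simp: mat_ker_def)
qed

text \<open>
  The quadratic form is continuous and so has a positive minimum on the compact unit sphere of
  \<open>K\<close>; homogeneity extends the bound.
\<close>

lemma pos_def_on_coercive:
  fixes Q :: "real ^ 'n ^ 'n"
  assumes Q: "pos_def_on K Q" and K: "subspace K"
  obtains c where "c > 0" "\<And>u. u \<in> K \<Longrightarrow> c * (norm u)\<^sup>2 \<le> u \<bullet> (Q *v u)"
proof (cases "K \<inter> sphere 0 1 = {}")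
  case True
  have "u = 0" if "u \<in> K" for u
  proof (rule ccontr)
    assume "u \<noteq> 0"
    then have "(1 / norm u) *\<^sub>R u \<in> K \<inter> sphere 0 1"
      using that K by (auto simp: subspace_def)
    with True show False by blast
  qed
  then show ?thesis using that[of 1] by force
next
  case False
  have "compact (K \<inter> sphere 0 1)"
    using closed_subspace[OF K] by (intro closed_Int_compact) auto
  moreover have "continuous_on (K \<inter> sphere 0 1) (\<lambda>u. u \<bullet> (Q *v u))"
    by (intro continuous_intros)
  ultimately obtain w where w: "w \<in> K \<inter> sphere 0 1"
    and min: "\<And>u. u \<in> K \<inter> sphere 0 1 \<Longrightarrow> w \<bullet> (Q *v w) \<le> u \<bullet> (Q *v u)"
    using continuous_attains_inf[OF _ False] by blast
  show ?thesis
  proof (rule that[of "w \<bullet> (Q *v w)"])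
    show "w \<bullet> (Q *v w) > 0" using w Q by (auto simp: pos_def_on_def)
    fix u assume u: "u \<in> K"
    show "w \<bullet> (Q *v w) * (norm u)\<^sup>2 \<le> u \<bullet> (Q *v u)"
    proof (cases "u = 0")
      case False
      define e where "e = (1 / norm u) *\<^sub>R u"
      have e: "e \<in> K \<inter> sphere 0 1" and ue: "u = norm u *\<^sub>R e"
        using u K False by (auto simp: subspace_def e_def)
      have "u \<bullet> (Q *v u) = (norm u)\<^sup>2 * (e \<bullet> (Q *v e))"
        by (subst (1 2) ue) (simp only: matrix_vector_mult_scaleR inner_scaleR_left
            inner_scaleR_right power2_eq_square mult.assoc)
      then show ?thesis using min[OF e] by (simp add: mult.commute[of "(norm u)\<^sup>2"] mult_right_mono)
    qed simp
  qed
qed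

lemma bounded_linear_mat_vec: "bounded_linear (\<lambda>X :: real ^ 'n ^ 'm. X *v w)"
proof -
  have "linear (\<lambda>X :: real ^ 'n ^ 'm. X *v w)"
    by (intro linearI) (simp_all add: matrix_vector_mult_add_rdistrib scaleR_matrix_vector_assoc)
  then show ?thesis by (simp add: linear_linear)
qed

text \<open>
  The sketching part of the problem.  Below, \<open>Zi\<close> stands for the pseudo-inverse of the mean
  sketch matrix \<open>Z\<close> and \<open>K\<close> for the kernel of the constraint matrix.
\<close>

locale sketching =
  fixes A :: "real ^ 'n ^ 'm" and M :: "real ^ 'n ^ 'n" and D :: "real mat measure"
  assumes M: "sym_pos_semidef M" "pos_def_on (mat_ker A) M"
    and D: "sketch_distribution TYPE('n) D"
    and finite_mean: "integrable D (sketch_Z A M)"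
    and Z_pos_def: "pos_def_on (mat_ker A) (mean_Z A M D)"
begin

abbreviation "Zs \<equiv> sketch_Z A M"
abbreviation "Z \<equiv> mean_Z A M D"
abbreviation "Zi \<equiv> pseudo_inverse Z"
abbreviation "K \<equiv> mat_ker A"

sublocale D: prob_space D
  using D by (simp add: sketch_distribution_def)

lemma M_sym: "x \<bullet> (M *v y) = (M *v x) \<bullet> y"
  using M(1) by (intro inner_symmetric_matrix) (simp add: sym_pos_semidef_def)

lemma M_nonneg: "x \<bullet> (M *v x) \<ge> 0"
  using M(1) by (simp add: sym_pos_semidef_def)

lemma
  assumes S: "S \<in> space D"
  shows Zs_sym: "x \<bullet> (Zs S *v y) = (Zs S *v x) \<bullet> y"
    and Zs_M: "(Zs S *v x) \<bullet> (M *v (Zs S *v y)) = x \<bullet> (Zs S *v y)"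
    and Zs_ker: "Zs S *v x \<in> K"
proof -
  have S': "dim_row S = CARD('n)" and M': "transpose M = M"
    using S D M by (auto simp: sketch_distribution_def sym_pos_semidef_def)
  note alg = sketch_Z_algebra[OF S' M', of A]
  show sym: "x \<bullet> (Zs S *v y) = (Zs S *v x) \<bullet> y" for x y
    by (rule inner_symmetric_matrix, rule alg)
  have "(Zs S *v x) \<bullet> (M *v (Zs S *v y)) = x \<bullet> ((Zs S ** M ** Zs S) *v y)"
    by (simp add: sym[symmetric] matrix_vector_mul_assoc matrix_mul_assoc)
  then show "(Zs S *v x) \<bullet> (M *v (Zs S *v y)) = x \<bullet> (Zs S *v y)"
    by (simp only: alg)
  show "Zs S *v x \<in> K"
    by (simp add: mat_ker_def matrix_vector_mul_assoc alg)
qed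

text \<open>
  For \<open>z = Z\<^sub>S x\<close> the identity \<open>Z\<^sub>S M Z\<^sub>S = Z\<^sub>S\<close> reads \<open>z \<bullet> M z = x \<bullet> z\<close>.  The left side is at
  least \<open>c * norm z\<^sup>2\<close> and the right side at most \<open>norm x * norm z\<close>.
\<close>

lemma Zs_bounded:
  obtains C where "\<And>S x. S \<in> space D \<Longrightarrow> norm (Zs S *v x) \<le> C * norm x"
proof -
  obtain c where c: "c > 0" and coercive: "\<And>u. u \<in> K \<Longrightarrow> c * (norm u)\<^sup>2 \<le> u \<bullet> (M *v u)"
    using pos_def_on_coercive[OF M(2) subspace_mat_ker] by blast
  show ?thesis
  proof (rule that[of "1 / c"])
    fix S x assume S: "S \<in> space D"
    let ?z = "Zs S *v x"
    have "c * (norm ?z)\<^sup>2 \<le> x \<bullet> ?z"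
      using coercive[OF Zs_ker[OF S]] by (simp add: Zs_M[OF S])
    also have "\<dots> \<le> norm x * norm ?z"
      by (rule norm_cauchy_schwarz)
    finally have "norm ?z * (c * norm ?z) \<le> norm ?z * norm x"
      by (simp add: power2_eq_square algebra_simps)
    then have "c * norm ?z \<le> norm x"
      by (cases "?z = 0") auto
    then show "norm ?z \<le> 1 / c * norm x"
      using c by (simp add: field_simps)
  qed
qed

lemma Zs_vec_measurable [measurable]: "(\<lambda>S. Zs S *v x) \<in> borel_measurable D"
  by (rule borel_measurable_integrable, rule integrable_bounded_linear[OF bounded_linear_mat_vec finite_mean])

lemma integrable_Zs_vec: "integrable D (\<lambda>S. Zs S *v x)"
  by (rule integrable_bounded_linear[OF bounded_linear_mat_vec finite_mean])

lemma integral_Zs_vec: "(\<integral>S. Zs S *v x \<partial>D) = Z *v x"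
  unfolding mean_Z_def by (rule integral_bounded_linear[OF bounded_linear_mat_vec finite_mean])

lemma integral_inner_Zs: "(\<integral>S. x \<bullet> (Zs S *v y) \<partial>D) = x \<bullet> (Z *v y)"
  by (simp add: integrable_Zs_vec integral_Zs_vec)

lemma Z_sym: "x \<bullet> (Z *v y) = (Z *v x) \<bullet> y"
proof -
  have "x \<bullet> (Z *v y) = (\<integral>S. y \<bullet> (Zs S *v x) \<partial>D)"
    unfolding integral_inner_Zs[symmetric]
    by (rule Bochner_Integration.integral_cong) (rule refl, metis Zs_sym inner_commute)
  also have "\<dots> = y \<bullet> (Z *v x)" by (rule integral_inner_Zs)
  finally show ?thesis by (simp only: inner_commute)
qed

lemma transpose_Z: "transpose Z = Z"
proof -
  have "(transpose Z *v x) \<bullet> y = (Z *v x) \<bullet> y" for x y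
    by (simp add: dot_lmul_matrix Z_sym)
  then have "transpose Z *v x = Z *v x" for x
    by (metis vector_eq_rdot)
  then show ?thesis by (simp add: matrix_eq)
qed

lemma Zs_nonneg: "S \<in> space D \<Longrightarrow> x \<bullet> (Zs S *v x) \<ge> 0"
  using M_nonneg[of "Zs S *v x"] by (simp add: Zs_M)

lemma Z_nonneg: "x \<bullet> (Z *v x) \<ge> 0"
  unfolding integral_inner_Zs[symmetric] by (intro integral_nonneg_AE AE_I2 Zs_nonneg)

lemma Z_ker: "Z *v x \<in> K"
proof -
  have "A *v (Z *v x) = (\<integral>S. A *v (Zs S *v x) \<partial>D)"
    unfolding integral_Zs_vec[symmetric]
    by (intro integral_bounded_linear[symmetric] integrable_Zs_vec matrix_vector_mul_bounded_linear)
  also have "\<dots> = (\<integral>S. 0 \<partial>D)"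
    using Zs_ker by (intro Bochner_Integration.integral_cong) (auto simp: mat_ker_def)
  finally show ?thesis by (simp add: mat_ker_def)
qed

lemma Zi_sym: "x \<bullet> (Zi *v y) = (Zi *v x) \<bullet> y"
  using pseudo_inverse_transpose[of Z] by (intro inner_symmetric_matrix) (simp add: transpose_Z)

lemma Z_Zi_commute: "Z *v (Zi *v x) = Zi *v (Z *v x)"
proof -
  have "transpose Zi = Zi" using pseudo_inverse_transpose[of Z] by (simp add: transpose_Z)
  then have "Z ** Zi = Zi ** Z"
    using pseudo_inverse_inverse(3)[of Z] by (simp add: matrix_transpose_mul transpose_Z)
  then show ?thesis by (simp add: matrix_vector_mul_assoc)
qed

lemma Z_Zi_Z: "Z *v (Zi *v (Z *v x)) = Z *v x"
  using pseudo_inverse_inverse(1)[of Z] by (simp add: matrix_vector_mul_assoc matrix_mul_assoc)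

lemma Zi_Z_Zi: "Zi *v (Z *v (Zi *v x)) = Zi *v x"
  using pseudo_inverse_inverse(2)[of Z] by (simp add: matrix_vector_mul_assoc matrix_mul_assoc)

lemma Zi_ker: "Zi *v x \<in> K"
  using Z_ker[of "Zi *v (Zi *v x)"] by (simp only: Z_Zi_commute[of "Zi *v x"] Zi_Z_Zi)

text \<open>
  \<open>Z Z\<^sup>+\<close> is the identity on \<open>K\<close>: the residual of \<open>u\<close> lies in \<open>K\<close> and is annihilated by \<open>Z\<close>, which
  is positive definite there.
\<close>

lemma Z_Zi_ker:
  assumes u: "u \<in> K"
  shows "Z *v (Zi *v u) = u"
proof -
  define w where "w = u - Z *v (Zi *v u)"
  have "w \<in> K"
    unfolding w_def by (intro subspace_diff subspace_mat_ker u Z_ker)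
  moreover have "Z *v w = 0"
    by (simp add: w_def matrix_vector_mult_diff_distrib Z_Zi_commute[of u] Z_Zi_Z)
  ultimately have "w = 0"
    using Z_pos_def by (metis pos_def_on_def inner_zero_right less_irrefl)
  then show ?thesis by (simp add: w_def)
qed

lemma Zi_nonneg: "x \<bullet> (Zi *v x) \<ge> 0"
  using Z_nonneg[of "Zi *v x"] by (metis Zi_sym Zi_Z_Zi)

lemma Zi_pos:
  assumes "u \<in> K" "u \<noteq> 0"
  shows "u \<bullet> (Zi *v u) > 0"
proof -
  have "Zi *v u \<noteq> 0" using Z_Zi_ker[OF assms(1)] assms(2) by auto
  then have "(Zi *v u) \<bullet> (Z *v (Zi *v u)) > 0"
    using Z_pos_def Zi_ker by (auto simp: pos_def_on_def)
  then show ?thesis using Z_Zi_ker[OF assms(1)] by (simp add: inner_commute)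
qed

lemma norm_Z_power2: "(mat_norm Z x)\<^sup>2 = x \<bullet> (Z *v x)"
  by (rule mat_norm_power2, rule Z_nonneg)

lemma norm_Zi_power2: "(mat_norm Zi x)\<^sup>2 = x \<bullet> (Zi *v x)"
  by (rule mat_norm_power2, rule Zi_nonneg)

text \<open>
  Put \<open>a = Z\<^sup>+ x\<close>, so that \<open>x \<bullet> u = a \<bullet> Z u\<close>.  The Cauchy--Schwarz inequality for the form \<open>Z\<close>
  bounds this by \<open>mat_norm Z a = mat_norm Z\<^sup>+ x\<close>, and the normalization of \<open>a\<close> attains the bound.
\<close>

lemma dual_norm_Z:
  assumes x: "x \<in> K"
  shows "dual_norm Z x = mat_norm Zi x"
proof -
  define a where "a = Zi *v x"
  define s where "s = mat_norm Zi x"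
  have Za: "Z *v a = x" using Z_Zi_ker[OF x] by (simp add: a_def)
  have s2: "s\<^sup>2 = a \<bullet> (Z *v a)"
    by (simp add: s_def norm_Zi_power2 Za) (simp add: a_def inner_commute)
  have s: "s \<ge> 0" by (simp add: s_def mat_norm_def Zi_nonneg)
  have xs: "x \<bullet> a = s\<^sup>2" by (simp add: s2 Za inner_commute)
  have ax: "a \<bullet> x = s\<^sup>2" by (simp add: s2 Za)
  have x0: "x = 0" if "s = 0"
    using Zi_pos[OF x] that norm_Zi_power2[of x] by (force simp: s_def)
  show ?thesis
    unfolding dual_norm_def s_def[symmetric]
  proof (rule Greatest_equality)
    show "\<exists>u. mat_norm Z u \<le> 1 \<and> s = x \<bullet> u"
    proof (cases "s = 0")
      case True
      then show ?thesis using x0 by (intro exI[of _ 0]) (simp add: mat_norm_def)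
    next
      case False
      have "(mat_norm Z ((1 / s) *\<^sub>R a))\<^sup>2 = 1"
        using False
        by (simp add: norm_Z_power2 matrix_vector_mult_scaleR s2[symmetric])
          (simp add: power2_eq_square)
      then have "mat_norm Z ((1 / s) *\<^sub>R a) \<le> 1"
        unfolding power2_eq_1_iff by (elim disjE) linarith+
      moreover have "s = x \<bullet> ((1 / s) *\<^sub>R a)"
        using False by (simp add: xs power2_eq_square)
      ultimately show ?thesis by blast
    qed
    fix t assume "\<exists>u. mat_norm Z u \<le> 1 \<and> t = x \<bullet> u"
    then obtain u where u: "mat_norm Z u \<le> 1" and t: "t = x \<bullet> u" by blast
    have "mat_norm Z u \<ge> 0" by (simp add: mat_norm_def Z_nonneg)
    then have u1: "u \<bullet> (Z *v u) \<le> 1"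
      using u power_mono[of "mat_norm Z u" 1 2] by (simp add: norm_Z_power2)
    have "0 \<le> (a - s *\<^sub>R u) \<bullet> (Z *v (a - s *\<^sub>R u))" by (rule Z_nonneg)
    also have "\<dots> = s\<^sup>2 - 2 * s * (x \<bullet> u) + s\<^sup>2 * (u \<bullet> (Z *v u))"
      using Z_sym[of a u] ax
      by (simp add: Za inner_commute[of u x] algebra_simps power2_eq_square)
    also have "\<dots> \<le> s\<^sup>2 - 2 * s * (x \<bullet> u) + s\<^sup>2 * 1"
      using u1 by (intro add_left_mono mult_left_mono) auto
    finally have "s * (x \<bullet> u) \<le> s * s" by (simp add: power2_eq_square)
    then show "t \<le> s"
      using s x0 t by (cases "s = 0") auto
  qed
qed

lemma integrable_quadratic: "integrable D (\<lambda>S. (Zs S *v a) \<bullet> (Q *v (Zs S *v b)))"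
proof -
  obtain C where C: "\<And>S x. S \<in> space D \<Longrightarrow> norm (Zs S *v x) \<le> C * norm x"
    using Zs_bounded by blast
  obtain B where B: "\<And>y. norm (Q *v y) \<le> norm y * B"
    using bounded_linear.bounded[OF matrix_vector_mul_bounded_linear[of Q]] by blast
  show ?thesis
  proof (rule D.integrable_const_bound[where B = "C * norm a * (C * norm b * \<bar>B\<bar>)"])
    show "AE S in D. norm ((Zs S *v a) \<bullet> (Q *v (Zs S *v b))) \<le> C * norm a * (C * norm b * \<bar>B\<bar>)"
    proof (rule AE_I2)
      fix S assume S: "S \<in> space D"
      have "norm ((Zs S *v a) \<bullet> (Q *v (Zs S *v b))) \<le> norm (Zs S *v a) * norm (Q *v (Zs S *v b))"
        by (simp add: Cauchy_Schwarz_ineq2)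
      also have "norm (Q *v (Zs S *v b)) \<le> norm (Zs S *v b) * \<bar>B\<bar>"
        by (rule order_trans[OF B]) (intro mult_left_mono, auto)
      also have "norm (Zs S *v b) * \<bar>B\<bar> \<le> C * norm b * \<bar>B\<bar>"
        by (intro mult_right_mono C S) auto
      also have "norm (Zs S *v a) * (C * norm b * \<bar>B\<bar>) \<le> C * norm a * (C * norm b * \<bar>B\<bar>)"
        by (intro mult_right_mono C S mult_nonneg_nonneg order_trans[OF norm_ge_zero C[OF S, of b]]) auto
      finally show "norm ((Zs S *v a) \<bullet> (Q *v (Zs S *v b))) \<le> C * norm a * (C * norm b * \<bar>B\<bar>)"
        by (simp add: mult_left_mono)
    qed
    have "(\<lambda>S. Q *v (Zs S *v b)) \<in> borel_measurable D"
      by (rule measurable_compose[OF Zs_vec_measurable borel_measurable_continuous_onI])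
        (intro continuous_intros)
    then show "(\<lambda>S. (Zs S *v a) \<bullet> (Q *v (Zs S *v b))) \<in> borel_measurable D"
      by (intro borel_measurable_inner Zs_vec_measurable)
  qed
qed

text \<open>
  The form \<open>Q\<close> is nonnegative at \<open>Z\<^sub>S a - Z a\<close>; taking the mean of this gives Jensen's inequality.
\<close>

lemma jensen_quadratic:
  assumes sym: "\<And>x y. x \<bullet> (Q *v y) = (Q *v x) \<bullet> y" and nonneg: "\<And>x. x \<bullet> (Q *v x) \<ge> 0"
  shows "(Z *v a) \<bullet> (Q *v (Z *v a)) \<le> (\<integral>S. (Zs S *v a) \<bullet> (Q *v (Zs S *v a)) \<partial>D)"
proof -
  let ?z = "Z *v a"
  have eq: "(Zs S *v a - ?z) \<bullet> (Q *v (Zs S *v a - ?z)) =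
      (Zs S *v a) \<bullet> (Q *v (Zs S *v a)) - 2 * ((Q *v ?z) \<bullet> (Zs S *v a)) + ?z \<bullet> (Q *v ?z)" for S
    using sym[of "Zs S *v a" ?z] sym[of ?z "Zs S *v a"]
    by (simp add: matrix_vector_mult_diff_distrib inner_diff_left inner_diff_right inner_commute)
  have "0 \<le> (\<integral>S. (Zs S *v a - ?z) \<bullet> (Q *v (Zs S *v a - ?z)) \<partial>D)"
    by (intro integral_nonneg_AE AE_I2 nonneg)
  also have "\<dots> = (\<integral>S. (Zs S *v a) \<bullet> (Q *v (Zs S *v a)) \<partial>D)
      - 2 * ((Q *v ?z) \<bullet> ?z) + ?z \<bullet> (Q *v ?z)"
    unfolding eq
    by (simp add: integrable_quadratic integrable_Zs_vec integral_Zs_vec D.prob_space)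
  finally show ?thesis using sym[of ?z ?z] by simp
qed

text \<open>
  Jensen's inequality at \<open>a = Z\<^sup>+ u\<close>: the second moment with respect to \<open>M\<close> collapses to
  \<open>a \<bullet> Z a\<close> because \<open>Z\<^sub>S M Z\<^sub>S = Z\<^sub>S\<close>.
\<close>

lemma M_le_Zi:
  assumes u: "u \<in> K"
  shows "u \<bullet> (M *v u) \<le> u \<bullet> (Zi *v u)"
proof -
  let ?a = "Zi *v u"
  have "u \<bullet> (M *v u) \<le> (\<integral>S. (Zs S *v ?a) \<bullet> (M *v (Zs S *v ?a)) \<partial>D)"
    using jensen_quadratic[of M ?a, OF M_sym M_nonneg] by (simp add: Z_Zi_ker[OF u])
  also have "\<dots> = (\<integral>S. ?a \<bullet> (Zs S *v ?a) \<partial>D)"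
    by (intro Bochner_Integration.integral_cong refl Zs_M)
  also have "\<dots> = ?a \<bullet> (Z *v ?a)"
    by (rule integral_inner_Zs)
  also have "\<dots> = u \<bullet> (Zi *v u)"
    by (simp add: Z_Zi_ker[OF u] inner_commute)
  finally show ?thesis .
qed

lemma Z_le_second_moment: "u \<bullet> (Z *v u) \<le> (\<integral>S. (Zs S *v u) \<bullet> (Zi *v (Zs S *v u)) \<partial>D)"
  using jensen_quadratic[of Zi u, OF Zi_sym Zi_nonneg]
  by (simp add: Z_sym[symmetric] Z_Zi_Z)

text \<open>
  The integral is the diagonal of a bilinear form on a finite-dimensional space.
\<close>

lemma continuous_second_moment:
  "continuous_on U (\<lambda>u. \<integral>S. (Zs S *v u) \<bullet> (Zi *v (Zs S *v u)) \<partial>D)"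
proof -
  have "bilinear (\<lambda>a b. \<integral>S. (Zs S *v a) \<bullet> (Zi *v (Zs S *v b)) \<partial>D)"
    unfolding bilinear_def
    by (intro conjI allI linearI)
      (simp_all add: matrix_vector_right_distrib matrix_vector_mult_scaleR inner_add_left
        inner_add_right integrable_quadratic)
  then have "bounded_bilinear (\<lambda>a b. \<integral>S. (Zs S *v a) \<bullet> (Zi *v (Zs S *v b)) \<partial>D)"
    by (simp add: bilinear_conv_bounded_bilinear)
  from bounded_bilinear.continuous_on[OF this continuous_on_id continuous_on_id]
  show ?thesis .
qed

text \<open>
  \<open>nu_max\<close> is defined by \<open>GREATEST\<close>, which bounds the Rayleigh quotients only once one of them is
  known to be the largest.  A maximizer exists on the compact unit sphere of \<open>K\<close>, and the quotient
  is homogeneous of degree zero.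
\<close>

lemma second_moment_le_nu_max_ker:
  assumes u: "u \<in> K"
  shows "(\<integral>S. (Zs S *v u) \<bullet> (Zi *v (Zs S *v u)) \<partial>D) \<le> nu_max A M D * (u \<bullet> (Z *v u))"
proof (cases "u = 0")
  case False
  define q where "q u = (\<integral>S. (Zs S *v u) \<bullet> (Zi *v (Zs S *v u)) \<partial>D)" for u
  have Zpos: "w \<bullet> (Z *v w) > 0" if "w \<in> K" "w \<noteq> 0" for w
    using Z_pos_def that by (auto simp: pos_def_on_def)
  let ?U = "K \<inter> sphere 0 1"
  define e where "e w = (1 / norm w) *\<^sub>R w" for w :: "real ^ 'n"
  have e: "e w \<in> ?U" if "w \<in> K" "w \<noteq> 0" for w
    using that subspace_mat_ker[of A] by (auto simp: e_def subspace_def)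
  have "compact ?U"
    using closed_mat_ker by (intro closed_Int_compact) auto
  moreover have "?U \<noteq> {}" using e[OF u False] by blast
  moreover have "continuous_on ?U (\<lambda>w. q w / (w \<bullet> (Z *v w)))"
    unfolding q_def using Zpos
    by (intro continuous_intros continuous_second_moment) force
  ultimately have "\<exists>v\<in>?U. \<forall>w\<in>?U. q w / (w \<bullet> (Z *v w)) \<le> q v / (v \<bullet> (Z *v v))"
    by (rule continuous_attains_sup)
  then obtain v where v: "v \<in> ?U"
    and max: "\<And>w. w \<in> ?U \<Longrightarrow> q w / (w \<bullet> (Z *v w)) \<le> q v / (v \<bullet> (Z *v v))"
    by blast
  have homogeneous: "q (e w) / (e w \<bullet> (Z *v e w)) = q w / (w \<bullet> (Z *v w))" if "w \<noteq> 0" for w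
    using that unfolding q_def e_def by (simp add: matrix_vector_mult_scaleR)
  have "nu_max A M D = q v / (v \<bullet> (Z *v v))"
    unfolding nu_max_def Let_def norm_Z_power2 norm_Zi_power2 q_def[symmetric]
  proof (rule Greatest_equality)
    show "\<exists>u\<in>K. u \<noteq> 0 \<and> q v / (v \<bullet> (Z *v v)) = q u / (u \<bullet> (Z *v u))"
      using v by (intro bexI[of _ v]) auto
    fix t assume "\<exists>u\<in>K. u \<noteq> 0 \<and> t = q u / (u \<bullet> (Z *v u))"
    then obtain w where w: "w \<in> K" "w \<noteq> 0" "t = q w / (w \<bullet> (Z *v w))" by blast
    then show "t \<le> q v / (v \<bullet> (Z *v v))"
      using max[OF e[OF w(1,2)]] homogeneous by simp
  qed
  then have "q u / (u \<bullet> (Z *v u)) \<le> nu_max A M D"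
    using max[OF e[OF u False]] homogeneous[OF False] by simp
  then show ?thesis
    using Zpos[OF u False] by (simp add: q_def divide_le_eq)
qed simp

text \<open>
  Against vectors of \<open>K\<close> the matrix \<open>Z\<^sup>+ Z\<close> acts as the identity.  This turns a mean step measured
  in the \<open>Z\<^sup>+\<close> inner product into the Euclidean inner product with the gradient.
\<close>

lemma inner_Zi_Z:
  assumes d: "d \<in> K"
  shows "d \<bullet> (Zi *v (Z *v g)) = d \<bullet> g"
  by (simp add: Zi_sym Z_sym Z_Zi_ker[OF d])

text \<open>
  Gradients need not lie in \<open>K\<close>.  Their projection \<open>Z\<^sup>+ Z g\<close> does, and \<open>Z\<^sub>S\<close> and \<open>Z\<close> do not
  distinguish it from \<open>g\<close>.
\<close>

lemma second_moment_le_nu_max: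
  "(\<integral>S. (Zs S *v g) \<bullet> (Zi *v (Zs S *v g)) \<partial>D) \<le> nu_max A M D * (g \<bullet> (Z *v g))"
proof -
  define h where "h = Zi *v (Z *v g)"
  have Zs: "Zs S *v h = Zs S *v g" if S: "S \<in> space D" for S
  proof -
    have "(Zs S *v h) \<bullet> y = (Zs S *v g) \<bullet> y" for y
      using inner_Zi_Z[OF Zs_ker[OF S], of y g] unfolding h_def
      by (metis Zs_sym[OF S] inner_commute)
    then show ?thesis by (metis vector_eq_rdot)
  qed
  have "(\<integral>S. (Zs S *v g) \<bullet> (Zi *v (Zs S *v g)) \<partial>D) = (\<integral>S. (Zs S *v h) \<bullet> (Zi *v (Zs S *v h)) \<partial>D)"
    by (rule Bochner_Integration.integral_cong) (simp_all add: Zs)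
  also have "\<dots> \<le> nu_max A M D * (h \<bullet> (Z *v h))"
    by (rule second_moment_le_nu_max_ker) (simp add: h_def Zi_ker)
  also have "h \<bullet> (Z *v h) = g \<bullet> (Z *v g)"
    unfolding h_def Z_Zi_Z by (metis Z_sym Z_Zi_Z inner_commute)
  finally show ?thesis .
qed

lemma nu_max_ge_1:
  assumes "CARD('m) < CARD('n)"
  shows "nu_max A M D \<ge> 1"
proof -
  obtain u where u: "u \<in> K" "u \<noteq> 0" using mat_ker_nontrivial[OF assms] by blast
  then have "u \<bullet> (Z *v u) > 0" using Z_pos_def by (auto simp: pos_def_on_def)
  moreover have "u \<bullet> (Z *v u) \<le> nu_max A M D * (u \<bullet> (Z *v u))"
    using Z_le_second_moment second_moment_le_nu_max by (rule order_trans)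
  ultimately show ?thesis by simp
qed

end

section \<open>One iteration of the accelerated method\<close>

text \<open>
  One iteration of \<open>arsd\<close> as a function of the current pair, so that it can be integrated over the
  sketch matrix with the pair held fixed.
\<close>

definition arsd_step :: "(real ^ 'n \<Rightarrow> real ^ 'n) \<Rightarrow> real \<Rightarrow> real \<Rightarrow> real \<Rightarrow> real ^ 'n ^ 'n \<Rightarrow>
    (real ^ 'n) \<times> (real ^ 'n) \<Rightarrow> (real ^ 'n) \<times> (real ^ 'n)" where
  "arsd_step g a b c X = (\<lambda>(x, v). let y = a *\<^sub>R v + (1 - a) *\<^sub>R x in
     (y - X *v g y, b *\<^sub>R v + (1 - b) *\<^sub>R y - c *\<^sub>R (X *v g y)))"

lemma arsd_Suc_step:
  "arsd g Zs \<alpha> \<beta> \<gamma> x0 (Suc k)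
    = arsd_step g (\<alpha> k) (\<beta> k) (\<gamma> k) (Zs k) (arsd g Zs \<alpha> \<beta> \<gamma> x0 k)"
  by (simp add: arsd_step_def Let_def case_prod_beta)

lemma arsd_cong:
  "(\<And>j. j < k \<Longrightarrow> X j = Y j) \<Longrightarrow> arsd g X \<alpha> \<beta> \<gamma> x0 k = arsd g Y \<alpha> \<beta> \<gamma> x0 k"
  by (induction k) (simp_all only: arsd.simps(1) arsd_Suc_step less_Suc_eq simp_thms)

lemma mat_vec_uminus: "Q *v (- w) = - (Q *v w)" for Q :: "real ^ 'n ^ 'm"
  using matrix_vector_mult_scaleR[of Q "-1" w] by simp

text \<open>
  The defect is \<open>s * (1 - s)\<close> times the form at \<open>r - w\<close>.
\<close>

lemma quadratic_convex:
  fixes Q :: "real ^ 'n ^ 'n"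
  assumes sym: "\<And>x y. x \<bullet> (Q *v y) = (Q *v x) \<bullet> y" and nonneg: "\<And>x. x \<bullet> (Q *v x) \<ge> 0"
    and s: "0 \<le> s" "s \<le> 1"
  shows "(s *\<^sub>R r + (1 - s) *\<^sub>R w) \<bullet> (Q *v (s *\<^sub>R r + (1 - s) *\<^sub>R w))
    \<le> s * (r \<bullet> (Q *v r)) + (1 - s) * (w \<bullet> (Q *v w))"
proof -
  have comm: "w \<bullet> (Q *v r) = r \<bullet> (Q *v w)"
    using sym[of w r] inner_commute[of "Q *v w" r] by simp
  have "s * (r \<bullet> (Q *v r)) + (1 - s) * (w \<bullet> (Q *v w))
      - (s *\<^sub>R r + (1 - s) *\<^sub>R w) \<bullet> (Q *v (s *\<^sub>R r + (1 - s) *\<^sub>R w))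
    = s * (1 - s) * ((r - w) \<bullet> (Q *v (r - w)))"
    by (simp add: matrix_vector_right_distrib matrix_vector_mult_diff_distrib
        matrix_vector_mult_scaleR inner_add_left inner_add_right inner_diff_left
        inner_diff_right comm) (simp add: algebra_simps)
  also have "\<dots> \<ge> 0" using s nonneg by simp
  finally show ?thesis by simp
qed

locale sketched_problem = sketching A M D
  for A :: "real ^ 'n ^ 'm" and M :: "real ^ 'n ^ 'n" and D :: "real mat measure" +
  fixes b :: "real ^ 'm" and f :: "real ^ 'n \<Rightarrow> real" and gradf :: "real ^ 'n \<Rightarrow> real ^ 'n"
    and \<sigma> \<nu> :: real and xstar :: "real ^ 'n"
  assumes dims: "CARD('m) < CARD('n)"
    and grad: "\<And>x. GDERIV f x :> gradf x"
    and smooth: "\<And>x y. x \<in> feasible A b \<Longrightarrow> y \<in> feasible A b \<Longrightarrow>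
        f y \<le> f x + gradf x \<bullet> (y - x) + 1 / 2 * ((y - x) \<bullet> (M *v (y - x)))"
    and \<sigma>_pos: "\<sigma> > 0"
    and strongly_convex: "\<And>x y. x \<in> feasible A b \<Longrightarrow> y \<in> feasible A b \<Longrightarrow>
        f x \<ge> f y + gradf y \<bullet> (x - y) + \<sigma> / 2 * (dual_norm Z (x - y))\<^sup>2"
    and xstar: "is_arg_min f (\<lambda>x. x \<in> feasible A b) xstar"
    and \<nu>: "\<nu> \<ge> nu_max A M D"
begin

abbreviation "F \<equiv> feasible A b"

lemma xstar_feasible: "xstar \<in> F"
  using xstar by (simp add: is_arg_min_def)

lemma xstar_min: "x \<in> F \<Longrightarrow> f xstar \<le> f x"
  using xstar by (force simp: is_arg_min_def)

lemma feasible_diff: "x \<in> F \<Longrightarrow> y \<in> F \<Longrightarrow> x - y \<in> K"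
  by (simp add: feasible_def mat_ker_def matrix_vector_mult_diff_distrib)

lemma feasible_add: "x \<in> F \<Longrightarrow> u \<in> K \<Longrightarrow> x + u \<in> F"
  by (simp add: feasible_def mat_ker_def matrix_vector_right_distrib)

lemma feasible_minus: "x \<in> F \<Longrightarrow> u \<in> K \<Longrightarrow> x - u \<in> F"
  by (simp add: feasible_def mat_ker_def matrix_vector_mult_diff_distrib)

lemma feasible_affine:
  assumes "x \<in> F" "y \<in> F"
  shows "s *\<^sub>R x + (1 - s) *\<^sub>R y \<in> F"
proof -
  have "s *\<^sub>R x + (1 - s) *\<^sub>R y = y + s *\<^sub>R (x - y)" by (simp add: algebra_simps)
  moreover have "s *\<^sub>R (x - y) \<in> K"
    using subspace_mat_ker feasible_diff[OF assms] by (rule subspace_scale)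
  ultimately show ?thesis using feasible_add[OF assms(2)] by simp
qed

lemma strongly_convex_Zi:
  assumes "x \<in> F" "y \<in> F"
  shows "f x \<ge> f y + gradf y \<bullet> (x - y) + \<sigma> / 2 * ((x - y) \<bullet> (Zi *v (x - y)))"
  using strongly_convex[OF assms] by (simp add: dual_norm_Z feasible_diff assms norm_Zi_power2)

text \<open>
  Comparing the upper with the lower quadratic bound on \<open>f\<close> at \<open>xstar\<close> gives \<open>\<sigma> Z\<^sup>+ \<le> M\<close> on \<open>K\<close>,
  and \<open>M \<le> Z\<^sup>+\<close> there by Jensen's inequality.  The kernel \<open>K\<close> is not zero, as \<open>A\<close> has fewer rows
  than columns.
\<close>

lemma \<sigma>_le_1: "\<sigma> \<le> 1"
proof -
  obtain u where u: "u \<in> K" "u \<noteq> 0" using mat_ker_nontrivial[OF dims] by blast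
  have x: "xstar + u \<in> F" by (rule feasible_add[OF xstar_feasible u(1)])
  have "\<sigma> * (u \<bullet> (Zi *v u)) \<le> u \<bullet> (M *v u)"
    using smooth[OF xstar_feasible x] strongly_convex_Zi[OF x xstar_feasible] by simp
  also have "\<dots> \<le> u \<bullet> (Zi *v u)" by (rule M_le_Zi[OF u(1)])
  finally show ?thesis using Zi_pos[OF u] by simp
qed

lemma \<sigma>_le_\<nu>: "\<sigma> \<le> \<nu>"
  using \<sigma>_le_1 nu_max_ge_1[OF dims] \<nu> by linarith

definition potential :: "(real ^ 'n) \<times> (real ^ 'n) \<Rightarrow> real" where
  "potential = (\<lambda>(x, v). (v - xstar) \<bullet> (Zi *v (v - xstar)) + 2 / \<sigma> * (f x - f xstar))"

lemma potential_nonneg: "x \<in> F \<Longrightarrow> potential (x, v) \<ge> 0"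
  using Zi_nonneg[of "v - xstar"] xstar_min \<sigma>_pos by (simp add: potential_def)

text \<open>
  In the smoothness bound the quadratic term is \<open>Z\<^sub>S M Z\<^sub>S = Z\<^sub>S\<close> at the gradient, half of the
  linear term.
\<close>

lemma descent:
  assumes S: "S \<in> space D" and y: "y \<in> F"
  shows "f (y - Zs S *v gradf y) \<le> f y - 1 / 2 * (gradf y \<bullet> (Zs S *v gradf y))"
  using smooth[OF y feasible_minus[OF y Zs_ker[OF S]], of "gradf y"]
  by (simp add: Zs_M[OF S] matrix_vector_mult_diff_distrib mat_vec_uminus)

text \<open>
  The contraction in one iteration from a fixed feasible pair, with \<open>t = sqrt (\<sigma> / \<nu>)\<close>.  The new
  potential \<open>p S\<close> is at most \<open>q S\<close>, which is a constant plus terms linear and quadratic in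
  \<open>Z\<^sub>S g\<close> and can therefore be integrated exactly.
\<close>

lemma nn_integral_potential_step:
  assumes x: "x \<in> F" and v: "v \<in> F"
    and t: "0 < t" "t \<le> 1" "t\<^sup>2 * \<nu> = \<sigma>"
  shows "(\<integral>\<^sup>+S. ennreal (potential (arsd_step gradf (t / (1 + t)) (1 - t) (t / \<sigma>) (Zs S) (x, v))) \<partial>D)
    \<le> ennreal ((1 - t) * potential (x, v))"
proof -
  define \<alpha> where "\<alpha> = t / (1 + t)"
  define y where "y = \<alpha> *\<^sub>R v + (1 - \<alpha>) *\<^sub>R x"
  define g where "g = gradf y"
  define r where "r = v - xstar"
  define w where "w = y - xstar"
  define c where "c = (1 - t) *\<^sub>R r + t *\<^sub>R w"
  define p where "p S = potential (arsd_step gradf \<alpha> (1 - t) (t / \<sigma>) (Zs S) (x, v))" for S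
  define q where "q S = 2 / \<sigma> * (f y - 1 / 2 * (g \<bullet> (Zs S *v g)) - f xstar)
      + (c \<bullet> (Zi *v c) - 2 * (t / \<sigma>) * ((Zi *v c) \<bullet> (Zs S *v g))
          + (t / \<sigma>)\<^sup>2 * ((Zs S *v g) \<bullet> (Zi *v (Zs S *v g))))" for S
  have y_F: "y \<in> F" unfolding y_def by (rule feasible_affine[OF v x])
  have w_K: "w \<in> K" and r_K: "r \<in> K"
    by (simp_all add: w_def r_def feasible_diff y_F v xstar_feasible)
  have c_K: "c \<in> K"
    unfolding c_def by (intro subspace_add subspace_scale subspace_mat_ker r_K w_K)
  have p: "0 \<le> p S" "p S \<le> q S" if S: "S \<in> space D" for S
  proof -
    let ?z = "Zs S *v g"
    have x': "y - ?z \<in> F" by (rule feasible_minus[OF y_F Zs_ker[OF S]])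
    have v': "(1 - t) *\<^sub>R v + (1 - (1 - t)) *\<^sub>R y - (t / \<sigma>) *\<^sub>R ?z - xstar = c - (t / \<sigma>) *\<^sub>R ?z"
      by (simp add: c_def r_def w_def algebra_simps)
    have step: "arsd_step gradf \<alpha> (1 - t) (t / \<sigma>) (Zs S) (x, v)
        = (y - ?z, (1 - t) *\<^sub>R v + (1 - (1 - t)) *\<^sub>R y - (t / \<sigma>) *\<^sub>R ?z)"
      by (simp add: arsd_step_def Let_def y_def g_def)
    show "0 \<le> p S"
      unfolding p_def step by (rule potential_nonneg[OF x'])
    have p_eq: "p S = (c - (t / \<sigma>) *\<^sub>R ?z) \<bullet> (Zi *v (c - (t / \<sigma>) *\<^sub>R ?z)) + 2 / \<sigma> * (f (y - ?z) - f xstar)"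
      unfolding p_def step potential_def prod.case v' ..
    have "(c - (t / \<sigma>) *\<^sub>R ?z) \<bullet> (Zi *v (c - (t / \<sigma>) *\<^sub>R ?z)) =
        c \<bullet> (Zi *v c) - 2 * (t / \<sigma>) * ((Zi *v c) \<bullet> ?z) + (t / \<sigma>)\<^sup>2 * (?z \<bullet> (Zi *v ?z))"
      using Zi_sym[of c ?z] inner_commute[of ?z "Zi *v c"]
      by (simp add: matrix_vector_mult_diff_distrib matrix_vector_mult_scaleR inner_diff_left
          inner_diff_right power2_eq_square) (use \<sigma>_pos in \<open>simp add: field_simps\<close>)
    moreover have "2 / \<sigma> * (f (y - ?z) - f xstar) \<le> 2 / \<sigma> * (f y - 1 / 2 * (g \<bullet> ?z) - f xstar)"
      by (intro mult_left_mono) (use descent[OF S y_F] \<sigma>_pos in \<open>auto simp: g_def\<close>)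
    ultimately show "p S \<le> q S"
      unfolding p_eq q_def by linarith
  qed
  have q_integrable: "integrable D q"
    unfolding q_def by (intro Bochner_Integration.integrable_add Bochner_Integration.integrable_diff
        integrable_mult_right D.integrable_const integrable_inner_right integrable_Zs_vec integrable_quadratic)
  have "(\<integral>S. q S \<partial>D) = 2 / \<sigma> * (f y - 1 / 2 * (g \<bullet> (Z *v g)) - f xstar)
      + (c \<bullet> (Zi *v c) - 2 * (t / \<sigma>) * (c \<bullet> g)
          + (t / \<sigma>)\<^sup>2 * (\<integral>S. (Zs S *v g) \<bullet> (Zi *v (Zs S *v g)) \<partial>D))"
    unfolding q_def using inner_Zi_Z[OF c_K, of g] Zi_sym[of c "Z *v g"]
    by (simp add: integrable_quadratic integrable_Zs_vec integral_Zs_vec D.prob_space)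
  also have "\<dots> \<le> (1 - t) * potential (x, v)"
  proof -
    \<comment> \<open>\<open>t\<^sup>2 * \<nu> = \<sigma>\<close> makes the second moment cancel the mean decrease of \<open>f\<close>.\<close>
    have "(t / \<sigma>)\<^sup>2 * (\<integral>S. (Zs S *v g) \<bullet> (Zi *v (Zs S *v g)) \<partial>D)
        \<le> (t / \<sigma>)\<^sup>2 * (\<nu> * (g \<bullet> (Z *v g)))"
      using second_moment_le_nu_max[of g] mult_right_mono[OF \<nu> Z_nonneg[of g]]
      by (intro mult_left_mono) auto
    also have "\<dots> = (t\<^sup>2 * \<nu>) / \<sigma>\<^sup>2 * (g \<bullet> (Z *v g))"
      by (simp add: power_divide)
    also have "\<dots> = 1 / \<sigma> * (g \<bullet> (Z *v g))"
      unfolding t(3) using \<sigma>_pos by (simp add: power2_eq_square)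
    finally have noise: "(t / \<sigma>)\<^sup>2 * (\<integral>S. (Zs S *v g) \<bullet> (Zi *v (Zs S *v g)) \<partial>D)
        \<le> 1 / \<sigma> * (g \<bullet> (Z *v g))" .
    have convex: "c \<bullet> (Zi *v c) \<le> (1 - t) * (r \<bullet> (Zi *v r)) + t * (w \<bullet> (Zi *v w))"
      using quadratic_convex[of Zi "1 - t" r w, OF Zi_sym Zi_nonneg] t by (simp add: c_def)
    \<comment> \<open>\<open>\<alpha>\<close> is chosen so that \<open>y\<close> divides the segment from \<open>x\<close> to \<open>v\<close> in the ratio \<open>t : 1\<close>.\<close>
    have \<alpha>: "\<alpha> * (1 + t) = t" using t by (simp add: \<alpha>_def)
    have "(1 + t) *\<^sub>R y = (\<alpha> * (1 + t)) *\<^sub>R v + ((1 + t) - \<alpha> * (1 + t)) *\<^sub>R x"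
      by (simp add: y_def algebra_simps)
    then have "(1 + t) *\<^sub>R y = t *\<^sub>R v + x"
      unfolding \<alpha> by simp
    then have vy: "t *\<^sub>R (v - y) = y - x"
      by (simp add: algebra_simps)
    \<comment> \<open>Split the step direction into one part towards \<open>xstar\<close> and one towards \<open>x\<close>.\<close>
    have "t *\<^sub>R c = t *\<^sub>R w + (1 - t) *\<^sub>R (t *\<^sub>R (v - y))"
      by (simp add: c_def r_def w_def algebra_simps)
    then have "t *\<^sub>R c = t *\<^sub>R w + (1 - t) *\<^sub>R (y - x)"
      unfolding vy .
    from arg_cong[OF this, of "\<lambda>u. g \<bullet> u"]
    have "t * (c \<bullet> g) = t * (g \<bullet> w) + (1 - t) * (g \<bullet> (y - x))"
      by (simp add: inner_add_right inner_commute)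
    moreover have "g \<bullet> w \<ge> f y - f xstar + \<sigma> / 2 * (w \<bullet> (Zi *v w))"
    proof -
      have "xstar - y = - w" by (simp add: w_def)
      then show ?thesis
        using strongly_convex_Zi[OF xstar_feasible y_F]
        by (simp add: g_def mat_vec_uminus del: minus_diff_eq)
    qed
    then have "t * (g \<bullet> w) \<ge> t * (f y - f xstar + \<sigma> / 2 * (w \<bullet> (Zi *v w)))"
      using t by (intro mult_left_mono) auto
    moreover have "g \<bullet> (y - x) \<ge> f y - f x"
      using strongly_convex_Zi[OF x y_F] mult_nonneg_nonneg[OF less_imp_le[OF \<sigma>_pos] Zi_nonneg[of "x - y"]]
      by (simp add: g_def inner_diff_right)
    then have "(1 - t) * (g \<bullet> (y - x)) \<ge> (1 - t) * (f y - f x)"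
      using t by (intro mult_left_mono) auto
    ultimately have "t * (c \<bullet> g) \<ge> t * (f y - f xstar + \<sigma> / 2 * (w \<bullet> (Zi *v w))) + (1 - t) * (f y - f x)"
      by linarith
    then have "2 / \<sigma> * (t * (c \<bullet> g))
        \<ge> 2 / \<sigma> * (t * (f y - f xstar + \<sigma> / 2 * (w \<bullet> (Zi *v w))) + (1 - t) * (f y - f x))"
      using \<sigma>_pos by (intro mult_left_mono) auto
    also have "2 / \<sigma> * (t * (f y - f xstar + \<sigma> / 2 * (w \<bullet> (Zi *v w))) + (1 - t) * (f y - f x))
        = 2 / \<sigma> * (f y - f xstar) + t * (w \<bullet> (Zi *v w)) - (1 - t) * (2 / \<sigma> * (f x - f xstar))"
      using \<sigma>_pos by (simp add: field_simps)
    finally have linear: "2 / \<sigma> * (f y - f xstar) + t * (w \<bullet> (Zi *v w))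
        - (1 - t) * (2 / \<sigma> * (f x - f xstar)) \<le> 2 * (t / \<sigma>) * (c \<bullet> g)"
      by simp
    have "(1 - t) * potential (x, v) = (1 - t) * (r \<bullet> (Zi *v r)) + (1 - t) * (2 / \<sigma> * (f x - f xstar))"
      by (simp add: potential_def r_def distrib_left)
    moreover have "2 / \<sigma> * (f y - 1 / 2 * (g \<bullet> (Z *v g)) - f xstar)
        = 2 / \<sigma> * (f y - f xstar) - 1 / \<sigma> * (g \<bullet> (Z *v g))"
      using \<sigma>_pos by (simp add: field_simps)
    ultimately show ?thesis
      using noise convex linear by linarith
  qed
  finally have q_le: "(\<integral>S. q S \<partial>D) \<le> (1 - t) * potential (x, v)" .
  have "(\<integral>\<^sup>+S. ennreal (p S) \<partial>D) \<le> (\<integral>\<^sup>+S. ennreal (q S) \<partial>D)"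
    using p by (intro nn_integral_mono ennreal_leI) auto
  also have "\<dots> = ennreal (\<integral>S. q S \<partial>D)"
    using p order_trans by (intro nn_integral_eq_integral q_integrable AE_I2) blast
  also have "\<dots> \<le> ennreal ((1 - t) * potential (x, v))"
    using q_le by (rule ennreal_leI)
  finally show ?thesis by (simp add: p_def \<alpha>_def)
qed

end

section \<open>The random iteration\<close>

lemma continuous_on_GDERIV:
  assumes "\<And>x. GDERIV f x :> g x"
  shows "continuous_on U f"
  using assms by (intro continuous_at_imp_continuous_on ballI)
    (metis gderiv_def has_derivative_continuous)

text \<open>
  A gradient is a pointwise limit of continuous difference quotients, hence Borel measurable even
  if it is discontinuous.
\<close>

lemma borel_measurable_gradient:
  fixes f :: "'a::euclidean_space \<Rightarrow> real"
  assumes grad: "\<And>x. GDERIV f x :> g x"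
  shows "g \<in> borel_measurable borel"
proof -
  note f = continuous_on_GDERIV[OF grad]
  have "(\<lambda>x. g x \<bullet> i) \<in> borel_measurable borel" if i: "i \<in> Basis" for i
  proof (rule borel_measurable_LIMSEQ_real)
    fix n
    show "(\<lambda>x. (f (x + inverse (real (Suc n)) *\<^sub>R i) - f x) / inverse (real (Suc n)))
        \<in> borel_measurable borel"
      by (intro borel_measurable_continuous_onI continuous_intros continuous_on_compose2[OF f]) auto
  next
    fix x
    have "((\<lambda>h. x + h *\<^sub>R i) has_derivative (\<lambda>h. h *\<^sub>R i)) (at 0)"
      by (auto intro!: derivative_eq_intros)
    moreover have "(f has_derivative (\<lambda>h. h \<bullet> g x)) (at (x + 0 *\<^sub>R i))"
      using grad[of x] by (simp add: gderiv_def)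
    ultimately have "((\<lambda>h. f (x + h *\<^sub>R i)) has_derivative (\<lambda>h. (h *\<^sub>R i) \<bullet> g x)) (at 0)"
      by (rule has_derivative_compose)
    then have "((\<lambda>h. f (x + h *\<^sub>R i)) has_real_derivative (g x \<bullet> i)) (at 0)"
      by (simp add: has_field_derivative_def inner_commute mult_commute_abs)
    then have "((\<lambda>h. (f (x + h *\<^sub>R i) - f x) / h) \<longlongrightarrow> g x \<bullet> i) (at 0)"
      by (simp add: DERIV_def)
    moreover have "filterlim (\<lambda>n. inverse (real (Suc n))) (at 0) sequentially"
      using LIMSEQ_inverse_real_of_nat by (auto simp: filterlim_at simp del: of_nat_Suc)
    ultimately show "(\<lambda>n. (f (x + inverse (real (Suc n)) *\<^sub>R i) - f x) / inverse (real (Suc n)))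
        \<longlonglongrightarrow> g x \<bullet> i"
      by (rule filterlim_compose)
  qed
  then show ?thesis by (rule borel_measurable_euclidean_space[THEN iffD2, OF ballI])
qed

lemma borel_measurable_mat_vec:
  fixes X :: "'a \<Rightarrow> real ^ 'n ^ 'm"
  assumes X: "X \<in> borel_measurable N" and w: "w \<in> borel_measurable N"
  shows "(\<lambda>z. X z *v w z) \<in> borel_measurable N"
proof (rule borel_measurable_continuous_Pair[OF X w])
  show "continuous_on UNIV (\<lambda>p :: (real ^ 'n ^ 'm) \<times> (real ^ 'n). fst p *v snd p)"
    unfolding matrix_vector_mult_def by (intro continuous_intros)
qed

lemma borel_measurable_arsd_step:
  assumes g: "g \<in> borel_measurable borel"
    and X: "X \<in> borel_measurable N" and T: "T \<in> borel_measurable N"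
  shows "(\<lambda>z. arsd_step g a b c (X z) (T z)) \<in> borel_measurable N"
proof -
  have [measurable]: "(\<lambda>z. fst (T z)) \<in> borel_measurable N" "(\<lambda>z. snd (T z)) \<in> borel_measurable N"
    by (rule measurable_compose[OF T], rule borel_measurable_continuous_onI, intro continuous_intros)+
  define y where "y z = a *\<^sub>R snd (T z) + (1 - a) *\<^sub>R fst (T z)" for z
  have y [measurable]: "y \<in> borel_measurable N" unfolding y_def by measurable
  have [measurable]: "(\<lambda>z. X z *v g (y z)) \<in> borel_measurable N"
    by (rule borel_measurable_mat_vec[OF X measurable_compose[OF y g]])
  have "(\<lambda>z. arsd_step g a b c (X z) (T z)) = (\<lambda>z. (y z - X z *v g (y z),
      b *\<^sub>R snd (T z) + (1 - b) *\<^sub>R y z - c *\<^sub>R (X z *v g (y z))))"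
    by (simp add: arsd_step_def y_def Let_def case_prod_beta)
  then show ?thesis by simp
qed

text \<open>
  Taking \<open>J = {..<k}\<close>, so that only past sketches enter, is what makes the sketch of iteration \<open>k\<close>
  independent of the current pair.
\<close>

lemma borel_measurable_arsd:
  assumes g: "g \<in> borel_measurable borel" and k: "{..<k} \<subseteq> J"
  shows "(\<lambda>z. arsd g z \<alpha> \<beta> \<gamma> x0 k) \<in> borel_measurable (Pi\<^sub>M J (\<lambda>_. borel))"
  using k
proof (induction k)
  case 0
  then show ?case by simp
next
  case (Suc k)
  then have "k \<in> J" and "(\<lambda>z. arsd g z \<alpha> \<beta> \<gamma> x0 k) \<in> borel_measurable (Pi\<^sub>M J (\<lambda>_. borel))"
    by (auto simp: lessThan_Suc)
  then show ?case
    unfolding arsd_Suc_step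
    by (intro borel_measurable_arsd_step g measurable_component_singleton)
qed

text \<open>
  Freezing an independent variable: the joint law is the product of the marginals, and Tonelli's
  theorem integrates one of them after the other.
\<close>

lemma (in prob_space) nn_integral_indep_var:
  assumes indep: "indep_var M1 X M2 Y" and H: "H \<in> borel_measurable (M1 \<Otimes>\<^sub>M M2)"
  shows "(\<integral>\<^sup>+\<omega>. H (X \<omega>, Y \<omega>) \<partial>M) = (\<integral>\<^sup>+\<omega>. \<integral>\<^sup>+\<omega>'. H (X \<omega>, Y \<omega>') \<partial>M \<partial>M)"
proof -
  have X: "X \<in> measurable M M1" and Y: "Y \<in> measurable M M2"
    and joint: "distr M M1 X \<Otimes>\<^sub>M distr M M2 Y = distr M (M1 \<Otimes>\<^sub>M M2) (\<lambda>\<omega>. (X \<omega>, Y \<omega>))"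
    using indep by (simp_all add: indep_var_distribution_eq)
  interpret Y: prob_space "distr M M2 Y" by (rule prob_space_distr[OF Y])
  have H': "H \<in> borel_measurable (distr M M1 X \<Otimes>\<^sub>M distr M M2 Y)"
    using H by (simp cong: measurable_cong_sets sets_pair_measure_cong)
  have "(\<integral>\<^sup>+\<omega>. H (X \<omega>, Y \<omega>) \<partial>M) = (\<integral>\<^sup>+z. H z \<partial>(distr M M1 X \<Otimes>\<^sub>M distr M M2 Y))"
    unfolding joint using H X Y by (subst nn_integral_distr) auto
  also have "\<dots> = (\<integral>\<^sup>+a. \<integral>\<^sup>+b. H (a, b) \<partial>distr M M2 Y \<partial>distr M M1 X)"
    by (rule Y.nn_integral_fst[symmetric, OF H'])
  also have "\<dots> = (\<integral>\<^sup>+\<omega>. \<integral>\<^sup>+b. H (X \<omega>, b) \<partial>distr M M2 Y \<partial>M)"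
    by (rule nn_integral_distr[OF X], rule Y.borel_measurable_nn_integral_fst, rule H')
  also have "\<dots> = (\<integral>\<^sup>+\<omega>. \<integral>\<^sup>+\<omega>'. H (X \<omega>, Y \<omega>') \<partial>M \<partial>M)"
  proof (rule nn_integral_cong)
    fix \<omega> assume "\<omega> \<in> space M"
    then have "X \<omega> \<in> space M1" using X by (auto dest: measurable_space)
    then have "(\<lambda>b. H (X \<omega>, b)) \<in> borel_measurable M2"
      by (rule measurable_compose[OF measurable_Pair1' H])
    then show "(\<integral>\<^sup>+b. H (X \<omega>, b) \<partial>distr M M2 Y) = (\<integral>\<^sup>+\<omega>'. H (X \<omega>, Y \<omega>') \<partial>M)"
      by (intro nn_integral_distr[OF Y]) simp
  qed
  finally show ?thesis .
qed

context sketched_problem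
begin

lemma arsd_feasible:
  assumes "\<And>j u. X j *v u \<in> K" "x0 \<in> F"
  shows "arsd gradf X \<alpha> \<beta> \<gamma> x0 k \<in> F \<times> F"
proof (induction k)
  case (Suc k)
  obtain x v where xv: "arsd gradf X \<alpha> \<beta> \<gamma> x0 k = (x, v)" by fastforce
  then have "x \<in> F" "v \<in> F" using Suc by auto
  then show ?case
    unfolding arsd_Suc_step xv using assms(1)
    by (auto simp: arsd_step_def Let_def intro!: feasible_minus feasible_affine
        subspace_scale[OF subspace_mat_ker])
qed (use assms in simp)

lemma borel_measurable_potential: "potential \<in> borel_measurable borel"
proof (rule borel_measurable_continuous_onI)
  note f = continuous_on_GDERIV[OF grad]
  show "continuous_on UNIV potential"
    unfolding potential_def case_prod_beta
    by (intro continuous_intros continuous_on_compose2[OF f[of UNIV]]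
        continuous_on_compose2[OF matrix_vector_mult_linear_continuous_on[of UNIV]]) auto
qed

text \<open>
  Given the past, iteration \<open>k\<close> averages the potential over a fresh sketch and so contracts it by
  \<open>1 - t\<close>.
\<close>

lemma nn_integral_potential_arsd:
  fixes S :: "nat \<Rightarrow> 'w \<Rightarrow> real mat"
  assumes P: "prob_space P"
    and S_indep: "prob_space.indep_vars P (\<lambda>_. D) S UNIV"
    and S_distr: "\<And>k. distr P D (S k) = D"
    and t: "0 < t" "t \<le> 1" "t\<^sup>2 * \<nu> = \<sigma>"
    and param: "\<And>k. \<alpha> k = t / (1 + t)" "\<And>k. \<beta> k = 1 - t" "\<And>k. \<gamma> k = t / \<sigma>"
    and x0: "x0 \<in> F"
  shows "(\<integral>\<^sup>+\<omega>. ennreal (potential (arsd gradf (\<lambda>j. Zs (S j \<omega>)) \<alpha> \<beta> \<gamma> x0 k)) \<partial>P)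
    \<le> ennreal ((1 - t) ^ k * potential (x0, x0))"
proof (induction k)
  case 0
  interpret P: prob_space P by fact
  show ?case by (simp add: P.emeasure_space_1)
next
  case (Suc k)
  interpret P: prob_space P by fact
  define W where "W j \<omega> = Zs (S j \<omega>)" for j \<omega>
  define G where "G z = arsd gradf z \<alpha> \<beta> \<gamma> x0 k" for z
  define T where "T = arsd_step gradf (t / (1 + t)) (1 - t) (t / \<sigma>)"
  define H where "H = (\<lambda>(z, z'). ennreal (potential (T (z' k) (G z))))"
  let ?past = "\<lambda>\<omega>. restrict (\<lambda>j. W j \<omega>) {..<k}" and ?now = "\<lambda>\<omega>. restrict (\<lambda>j. W j \<omega>) {k}"
  let ?M = "\<lambda>J. Pi\<^sub>M J (\<lambda>_. borel :: (real ^ 'n ^ 'n) measure)"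
  have S_meas: "S j \<in> measurable P D" for j
    using S_indep by (simp add: P.indep_vars_def)
  have W_ker: "W j \<omega> *v u \<in> K" if "\<omega> \<in> space P" for j \<omega> u
    unfolding W_def using that S_meas by (intro Zs_ker) (auto dest: measurable_space)
  note gradf = borel_measurable_gradient[OF grad]
  have Zs: "Zs \<in> borel_measurable D"
    using finite_mean by (rule borel_measurable_integrable)
  have "P.indep_vars (\<lambda>_. borel) W UNIV"
    unfolding W_def by (rule P.indep_vars_compose2[OF S_indep Zs])
  then have indep: "P.indep_var (?M {..<k}) ?past (?M {k}) ?now"
    by (rule P.indep_var_restrict) auto
  have H: "H \<in> borel_measurable (?M {..<k} \<Otimes>\<^sub>M ?M {k})"
  proof -
    have "(\<lambda>p. G (fst p)) \<in> borel_measurable (?M {..<k} \<Otimes>\<^sub>M ?M {k})"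
      unfolding G_def by (rule measurable_compose[OF measurable_fst borel_measurable_arsd[OF gradf]]) simp
    moreover have "(\<lambda>p. snd p k) \<in> borel_measurable (?M {..<k} \<Otimes>\<^sub>M ?M {k})"
      by (rule measurable_compose[OF measurable_snd measurable_component_singleton]) simp
    ultimately have "(\<lambda>p. T (snd p k) (G (fst p))) \<in> borel_measurable (?M {..<k} \<Otimes>\<^sub>M ?M {k})"
      unfolding T_def by (intro borel_measurable_arsd_step gradf)
    from measurable_compose[OF measurable_compose[OF this borel_measurable_potential] measurable_ennreal]
    show ?thesis by (simp add: H_def case_prod_beta)
  qed
  have past: "G (?past \<omega>) = G (\<lambda>j. W j \<omega>)" for \<omega>
    unfolding G_def by (rule arsd_cong) simp
  have "(\<integral>\<^sup>+\<omega>. ennreal (potential (arsd gradf (\<lambda>j. Zs (S j \<omega>)) \<alpha> \<beta> \<gamma> x0 (Suc k))) \<partial>P)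
      = (\<integral>\<^sup>+\<omega>. H (?past \<omega>, ?now \<omega>) \<partial>P)"
    unfolding arsd_Suc_step param(1)[of k] param(2)[of k] param(3)[of k] H_def prod.case past by (simp add: W_def G_def T_def)
  also have "\<dots> = (\<integral>\<^sup>+\<omega>. \<integral>\<^sup>+\<omega>'. H (?past \<omega>, ?now \<omega>') \<partial>P \<partial>P)"
    by (rule P.nn_integral_indep_var[OF indep H])
  also have "\<dots> \<le> (\<integral>\<^sup>+\<omega>. ennreal (1 - t) * ennreal (potential (G (\<lambda>j. W j \<omega>))) \<partial>P)"
  proof (rule nn_integral_mono)
    fix \<omega> assume \<omega>: "\<omega> \<in> space P"
    obtain x v where xv: "G (\<lambda>j. W j \<omega>) = (x, v)" by fastforce
    have "G (\<lambda>j. W j \<omega>) \<in> F \<times> F"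
      unfolding G_def by (rule arsd_feasible[OF W_ker[OF \<omega>] x0])
    then have F: "x \<in> F" "v \<in> F" by (simp_all add: xv)
    have next_potential: "H (?past \<omega>, ?now \<omega>') = ennreal (potential (T (Zs (S k \<omega>')) (x, v)))" for \<omega>'
      unfolding H_def prod.case past xv by (simp add: W_def)
    have "(\<lambda>Y. ennreal (potential (T (Zs Y) (x, v)))) \<in> borel_measurable D"
      unfolding T_def
      by (intro measurable_compose[OF _ measurable_ennreal] measurable_compose[OF _ borel_measurable_potential]
          borel_measurable_arsd_step gradf Zs) simp
    from nn_integral_distr[OF S_meas[of k], unfolded S_distr, OF this]
    have "(\<integral>\<^sup>+\<omega>'. H (?past \<omega>, ?now \<omega>') \<partial>P) = (\<integral>\<^sup>+Y. ennreal (potential (T (Zs Y) (x, v))) \<partial>D)"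
      by (simp add: next_potential)
    also have "\<dots> \<le> ennreal ((1 - t) * potential (x, v))"
      unfolding T_def by (rule nn_integral_potential_step[OF F t])
    finally show "(\<integral>\<^sup>+\<omega>'. H (?past \<omega>, ?now \<omega>') \<partial>P)
        \<le> ennreal (1 - t) * ennreal (potential (G (\<lambda>j. W j \<omega>)))"
      using t potential_nonneg[OF F(1)] by (simp add: xv ennreal_mult)
  qed
  also have "\<dots> = ennreal (1 - t) * (\<integral>\<^sup>+\<omega>. ennreal (potential (G (\<lambda>j. W j \<omega>))) \<partial>P)"
  proof (rule nn_integral_cmult)
    have "?past \<in> measurable P (?M {..<k})" by (rule P.indep_var_rv1[OF indep])
    from measurable_compose[OF this borel_measurable_arsd[OF gradf, of k "{..<k}" \<alpha> \<beta> \<gamma> x0]]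
    have "(\<lambda>\<omega>. G (\<lambda>j. W j \<omega>)) \<in> borel_measurable P"
      by (simp add: G_def[symmetric] past)
    then show "(\<lambda>\<omega>. ennreal (potential (G (\<lambda>j. W j \<omega>)))) \<in> borel_measurable P"
      by (intro measurable_compose[OF _ measurable_ennreal] measurable_compose[OF _ borel_measurable_potential])
  qed
  also have "\<dots> \<le> ennreal (1 - t) * ennreal ((1 - t) ^ k * potential (x0, x0))"
    using Suc by (intro mult_left_mono) (simp_all add: G_def W_def)
  also have "\<dots> = ennreal ((1 - t) ^ Suc k * potential (x0, x0))"
    using t potential_nonneg[OF x0] by (simp add: ennreal_mult[symmetric] mult.assoc)
  finally show ?case .
qed

end

section \<open>Linear convergence in expectation\<close>

theorem theorem4p5:
  fixes f :: "real ^ 'n \<Rightarrow> real"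
    and gradf :: "real ^ 'n \<Rightarrow> real ^ 'n"
    and A :: "real ^ 'n ^ 'm"
    and b :: "real ^ 'm"
    and M Z :: "real ^ 'n ^ 'n"
    and x0 xstar :: "real ^ 'n"
    and D :: "real mat measure"
    and P :: "'w measure"
    and S :: "nat \<Rightarrow> 'w \<Rightarrow> real mat"
    and \<alpha> \<beta> \<gamma> :: "nat \<Rightarrow> real"
    and x v :: "nat \<Rightarrow> 'w \<Rightarrow> real ^ 'n"
    and \<sigma> \<nu> fstar :: real
  assumes dims: "CARD('m) < CARD('n)"
    and grad: "\<And>x. GDERIV f x :> gradf x"
    and x0_feasible: "x0 \<in> feasible A b"
    and M: "sym_pos_semidef M" "pos_def_on (mat_ker A) M"
    and smooth: "\<And>x y. x \<in> feasible A b \<Longrightarrow> y \<in> feasible A b \<Longrightarrow>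
        f y \<le> f x + gradf x \<bullet> (y - x) + 1 / 2 * ((y - x) \<bullet> (M *v (y - x)))"
    and D: "sketch_distribution TYPE('n) D"
    and finite_mean: "integrable D (sketch_Z A M)"
    and Z_eq: "Z = mean_Z A M D"
    and Z_pos_def: "pos_def_on (mat_ker A) Z"
    and \<sigma>_pos: "\<sigma> > 0"
    and strongly_convex: "\<And>x y. x \<in> feasible A b \<Longrightarrow> y \<in> feasible A b \<Longrightarrow>
        f x \<ge> f y + gradf y \<bullet> (x - y) + \<sigma> / 2 * (dual_norm Z (x - y))\<^sup>2"
    and xstar: "is_arg_min f (\<lambda>x. x \<in> feasible A b) xstar"
    and fstar_eq: "fstar = optimal_value f A b"
    and P: "prob_space P"
    and S_indep: "prob_space.indep_vars P (\<lambda>_. D) S UNIV"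
    and S_distr: "\<And>k. distr P D (S k) = D"
    and \<nu>: "\<nu> \<ge> nu_max A M D"
    and \<gamma>: "\<And>k. \<gamma> k = 1 / sqrt (\<sigma> * \<nu>)"
    and \<alpha>: "\<And>k. \<alpha> k = \<gamma> k * \<sigma> / (1 + \<gamma> k * \<sigma>)"
    and \<beta>: "\<And>k. \<beta> k = 1 - \<gamma> k * \<sigma>"
    and run: "\<And>k \<omega>. \<omega> \<in> space P \<Longrightarrow>
        (x k \<omega>, v k \<omega>) = arsd gradf (\<lambda>j. sketch_Z A M (S j \<omega>)) \<alpha> \<beta> \<gamma> x0 k"
  shows "\<forall>k. \<gamma> k \<le> 1 / \<sigma> \<and> \<alpha> k \<in> {0<..1} \<and> \<beta> k \<in> {0..1} \<and>
    integrable P (\<lambda>\<omega>. (mat_norm (pseudo_inverse Z) (v k \<omega> - xstar))\<^sup>2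
                        + 2 / \<sigma> * (f (x k \<omega>) - fstar)) \<and>
    (\<integral>\<omega>. (mat_norm (pseudo_inverse Z) (v k \<omega> - xstar))\<^sup>2
            + 2 / \<sigma> * (f (x k \<omega>) - fstar) \<partial>P)
      \<le> (1 - sqrt (\<sigma> / \<nu>)) ^ k
          * ((mat_norm (pseudo_inverse Z) (x0 - xstar))\<^sup>2 + 2 / \<sigma> * (f x0 - fstar))"
proof
  fix k
  interpret sketched_problem A M D b f gradf \<sigma> \<nu> xstar
    by unfold_locales
      (use assms in \<open>simp_all only: Z_eq[symmetric] sketch_distribution_def\<close>)
  interpret P: prob_space P by (rule P)
  define t where "t = sqrt (\<sigma> / \<nu>)"
  have \<nu>_pos: "\<nu> > 0" using \<sigma>_pos \<sigma>_le_\<nu> by linarith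
  have t: "0 < t" "t \<le> 1" "t\<^sup>2 * \<nu> = \<sigma>"
    using \<sigma>_pos \<nu>_pos \<sigma>_le_\<nu> by (simp_all add: t_def)
  have "\<sigma> / sqrt (\<sigma> * \<nu>) = t"
    using \<sigma>_pos \<nu>_pos by (simp add: t_def real_sqrt_mult real_sqrt_divide real_div_sqrt field_simps)
  then have \<gamma>\<sigma>: "\<gamma> j * \<sigma> = t" for j by (simp add: \<gamma>)
  then have params: "\<alpha> j = t / (1 + t)" "\<beta> j = 1 - t" "\<gamma> j = t / \<sigma>" for j
    using \<sigma>_pos by (simp_all add: \<alpha> \<beta> \<gamma>\<sigma> eq_divide_eq)
  have fstar: "fstar = f xstar"
    unfolding fstar_eq optimal_value_def
    by (rule Least_equality) (use xstar_feasible xstar_min in auto)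
  have potential: "(mat_norm (pseudo_inverse Z) (w - xstar))\<^sup>2 + 2 / \<sigma> * (f u - fstar) = potential (u, w)"
    for u w by (simp add: potential_def Z_eq norm_Zi_power2 fstar)
  define p where "p \<omega> = potential (arsd gradf (\<lambda>j. sketch_Z A M (S j \<omega>)) \<alpha> \<beta> \<gamma> x0 k)" for \<omega>
  have p: "(mat_norm (pseudo_inverse Z) (v k \<omega> - xstar))\<^sup>2 + 2 / \<sigma> * (f (x k \<omega>) - fstar) = p \<omega>"
    if "\<omega> \<in> space P" for \<omega>
    unfolding potential p_def run[OF that] ..
  have S_meas: "S j \<in> measurable P D" for j
    using S_indep by (simp add: P.indep_vars_def)
  have "(\<lambda>\<omega> j. sketch_Z A M (S j \<omega>)) \<in> measurable P (Pi\<^sub>M UNIV (\<lambda>_. borel))"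
    using measurable_compose[OF S_meas borel_measurable_integrable[OF finite_mean]]
    by (intro measurable_PiM_single') auto
  from measurable_compose[OF this borel_measurable_arsd[OF borel_measurable_gradient[OF grad]]]
  have p_meas: "p \<in> borel_measurable P"
    unfolding p_def by (intro measurable_compose[OF _ borel_measurable_potential]) simp
  have p_nonneg: "p \<omega> \<ge> 0" if "\<omega> \<in> space P" for \<omega>
  proof -
    have "arsd gradf (\<lambda>j. sketch_Z A M (S j \<omega>)) \<alpha> \<beta> \<gamma> x0 k \<in> F \<times> F"
      using that S_meas by (intro arsd_feasible x0_feasible Zs_ker) (auto dest: measurable_space)
    then show ?thesis by (auto simp: p_def potential_nonneg)
  qed
  have bound: "(\<integral>\<^sup>+\<omega>. ennreal (p \<omega>) \<partial>P) \<le> ennreal ((1 - t) ^ k * potential (x0, x0))"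
    unfolding p_def by (rule nn_integral_potential_arsd[OF P S_indep S_distr t params x0_feasible])
  then have int: "integrable P p"
    using p_meas p_nonneg by (intro integrableI_nonneg AE_I2) (auto simp: le_less_trans)
  have "ennreal (\<integral>\<omega>. p \<omega> \<partial>P) \<le> ennreal ((1 - t) ^ k * potential (x0, x0))"
    using bound p_nonneg by (subst (asm) nn_integral_eq_integral[OF int AE_I2]) auto
  then have expectation: "(\<integral>\<omega>. p \<omega> \<partial>P) \<le> (1 - t) ^ k * potential (x0, x0)"
    using t potential_nonneg[OF x0_feasible] by (subst (asm) ennreal_le_iff) auto
  show "\<gamma> k \<le> 1 / \<sigma> \<and> \<alpha> k \<in> {0<..1} \<and> \<beta> k \<in> {0..1} \<and>
    integrable P (\<lambda>\<omega>. (mat_norm (pseudo_inverse Z) (v k \<omega> - xstar))\<^sup>2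
                        + 2 / \<sigma> * (f (x k \<omega>) - fstar)) \<and>
    (\<integral>\<omega>. (mat_norm (pseudo_inverse Z) (v k \<omega> - xstar))\<^sup>2
            + 2 / \<sigma> * (f (x k \<omega>) - fstar) \<partial>P)
      \<le> (1 - sqrt (\<sigma> / \<nu>)) ^ k
          * ((mat_norm (pseudo_inverse Z) (x0 - xstar))\<^sup>2 + 2 / \<sigma> * (f x0 - fstar))"
  proof (intro conjI)
    have p_expectation: "(\<integral>\<omega>. (mat_norm (pseudo_inverse Z) (v k \<omega> - xstar))\<^sup>2
        + 2 / \<sigma> * (f (x k \<omega>) - fstar) \<partial>P) = (\<integral>\<omega>. p \<omega> \<partial>P)"
      by (intro Bochner_Integration.integral_cong refl p)
    show "\<gamma> k \<le> 1 / \<sigma>" "\<alpha> k \<in> {0<..1}" "\<beta> k \<in> {0..1}"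
      using t \<sigma>_pos by (simp_all add: params divide_right_mono)
    show "integrable P (\<lambda>\<omega>. (mat_norm (pseudo_inverse Z) (v k \<omega> - xstar))\<^sup>2
        + 2 / \<sigma> * (f (x k \<omega>) - fstar))"
      by (subst Bochner_Integration.integrable_cong[OF refl p]) (auto intro: int)
    show "(\<integral>\<omega>. (mat_norm (pseudo_inverse Z) (v k \<omega> - xstar))\<^sup>2
            + 2 / \<sigma> * (f (x k \<omega>) - fstar) \<partial>P)
      \<le> (1 - sqrt (\<sigma> / \<nu>)) ^ k
          * ((mat_norm (pseudo_inverse Z) (x0 - xstar))\<^sup>2 + 2 / \<sigma> * (f x0 - fstar))"
      using expectation p_expectation by (simp only: potential t_def)
  qed
qed

end
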